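(* Let $g:[0,\infty)\to(0,\infty)$ be an $\mathrm{RV}_{-1}$-function with $\int_0^\infty g(t)\,dt=\infty$ and $t^{-1}=O(g(t))$ as $t\to\infty$. Let $T=T^*\in\mathcal L_g$. Assume there are constants $c^\pm$ and a decreasing function $\varepsilon:[t_0,\infty)\to(0,\infty)$ with $\lim_{t\to\infty}\varepsilon(t)=0$ such that $$\lambda_j^\pm(T)=g(j)\bigl(c^\pm+O(\varepsilon(j))\bigr)\ \text{ as } j\to\infty\qquad\text{and}\qquad \int_{t_0}^t\varepsilon(s)g(s)\,ds=O(tg(t))\ \text{ as } t\to\infty .$$ Then $T$ is $g$-hypermeasurable.
   Context: $\mathcal H$ is a separable (infinite-dimensional) Hilbert space, and $\mu_0(T)\ge\mu_1(T)\ge\cdots$ are the singular values of a compact operator $T$ on $\mathcal H$. A continuous function $g:[0,\infty)\to(0,\infty)$ is $\mathrm{RV}_{-1}$ if it is ultimately monotonic and $\lim_{t\to\infty}g(\lambda t)/g(t)=\lambda^{-1}$ for all $\lambda>0$. The weak Lorentz ideal is $\mathcal L_g=\{T \text{ compact}:\mu_j(T)=O(g(j))\}$. For $T=T^*$ compact, $\lambda_0^\pm(T)\ge\lambda_1^\pm(T)\ge\cdots\ge0$ are the positive/negative eigenvalue sequences, i.e. $\lambda_j^\pm(T)=\lambda_j(T^\pm)$ is the $j$-th eigenvalue, in non-increasing order counted with multiplicity, of $T^\pm=\tfrac12(|T|\pm T)$. A trace on $\mathcal L_g$ is a linear functional $\varphi:\mathcal L_g\to\mathbb C$ (no continuity or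 positivity required) vanishing on all commutators $[A,T]$ with $A$ bounded and $T\in\mathcal L_g$. It is $g$-normalized if $\varphi(T_g)=1$, where $T_g$ is any operator with $T_g\xi_j=g(j)\xi_j$, $j\ge0$, for some orthonormal basis $(\xi_j)_{j\ge0}$ of $\mathcal H$. An operator $T\in\mathcal L_g$ is $g$-hypermeasurable if all $g$-normalized traces on $\mathcal L_g$ take the same value on $T$. *)

theory Defs
  imports "HOL-Analysis.Analysis" "HOL-Library.Landau_Symbols" "HOL-Library.Nonpos_Ints"
begin

section \<open>Complex Hilbert spaces\<close>

text \<open>The inner product is antilinear in its first argument. Completeness comes from \<^class>\<open>banach\<close>,
  whose norm is tied to the inner product by \<open>cinner_self\<close>.\<close>

class complex_hilbert = banach +
  fixes scaleC :: "complex \<Rightarrow> 'a \<Rightarrow> 'a" (infixr \<open>*\<^sub>C\<close> 75)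
    and cinner :: "'a \<Rightarrow> 'a \<Rightarrow> complex"
  assumes scaleC_add_right: "c *\<^sub>C (x + y) = c *\<^sub>C x + c *\<^sub>C y"
    and scaleC_add_left: "(c + d) *\<^sub>C x = c *\<^sub>C x + d *\<^sub>C x"
    and scaleC_scaleC: "c *\<^sub>C (d *\<^sub>C x) = (c * d) *\<^sub>C x"
    and scaleR_scaleC: "r *\<^sub>R x = complex_of_real r *\<^sub>C x"
    and cinner_commute: "cinner x y = cnj (cinner y x)"
    and cinner_add_right: "cinner x (y + z) = cinner x y + cinner x z"
    and cinner_scaleC_right: "cinner x (c *\<^sub>C y) = c * cinner x y"
    and cinner_self: "cinner x x = complex_of_real ((norm x)\<^sup>2)"

lemma scaleC_one: "1 *\<^sub>C x = (x :: 'a::complex_hilbert)"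
  using scaleR_scaleC[of 1 x] by simp

global_interpretation complex_vector: vector_space "scaleC :: complex \<Rightarrow> 'a \<Rightarrow> 'a::complex_hilbert"
  defines cspan = complex_vector.span
    and cdim = complex_vector.dim
  by unfold_locales
    (simp_all add: scaleC_add_right scaleC_add_left scaleC_scaleC scaleC_one)

definition orthonormal_basis :: "(nat \<Rightarrow> 'a::complex_hilbert) \<Rightarrow> bool" where
  "orthonormal_basis \<xi> \<longleftrightarrow>
     (\<forall>i j. cinner (\<xi> i) (\<xi> j) = (if i = j then 1 else 0)) \<and>
     closure (cspan (range \<xi>)) = UNIV"


section \<open>Operators\<close>

definition bounded_clinear :: "('a::complex_hilbert \<Rightarrow> 'a) \<Rightarrow> bool" where
  "bounded_clinear T \<longleftrightarrow> bounded_linear T \<and> (\<forall>c x. T (c *\<^sub>C x) = c *\<^sub>C T x)"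

definition compact_op :: "('a::complex_hilbert \<Rightarrow> 'a) \<Rightarrow> bool" where
  "compact_op T \<longleftrightarrow> bounded_clinear T \<and> compact (closure (T ` cball 0 1))"

definition cadjoint :: "('a::complex_hilbert \<Rightarrow> 'a) \<Rightarrow> 'a \<Rightarrow> 'a" where
  "cadjoint T = (THE S. \<forall>x y. cinner (T x) y = cinner x (S y))"

definition positive_op :: "('a::complex_hilbert \<Rightarrow> 'a) \<Rightarrow> bool" where
  "positive_op P \<longleftrightarrow> bounded_clinear P \<and> (\<forall>x. cinner x (P x) \<in> \<real>\<^sub>\<ge>\<^sub>0)"

definition modulus :: "('a::complex_hilbert \<Rightarrow> 'a) \<Rightarrow> 'a \<Rightarrow> 'a" where
  "modulus T = (THE P. positive_op P \<and> P \<circ> P = cadjoint T \<circ> T)"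

definition pos_part :: "('a::complex_hilbert \<Rightarrow> 'a) \<Rightarrow> 'a \<Rightarrow> 'a" where
  "pos_part T = (\<lambda>x. (1 / 2) *\<^sub>R (modulus T x + T x))"

definition neg_part :: "('a::complex_hilbert \<Rightarrow> 'a) \<Rightarrow> 'a \<Rightarrow> 'a" where
  "neg_part T = (\<lambda>x. (1 / 2) *\<^sub>R (modulus T x - T x))"

text \<open>For a positive compact operator \<open>P\<close>, \<open>eigenvalues P\<close> lists the positive eigenvalues in
  non-increasing order, each one as often as the dimension of its eigenspace; if there are only
  finitely many, the list is continued by zeros. The sequence is determined by the condition below:
  being non-increasing, it can vanish only after all positive eigenvalues have been listed. The
  finiteness clause is needed since \<^const>\<open>card\<close> is zero on infinite sets.\<close>

definition eigenvalues :: "('a::complex_hilbert \<Rightarrow> 'a) \<Rightarrow> nat \<Rightarrow> real" where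
  "eigenvalues P = (THE l. antimono l \<and> (\<forall>j. 0 \<le> l j) \<and>
     (\<forall>t>0. finite {j. l j = t} \<and>
             card {j. l j = t} = cdim {x. P x = complex_of_real t *\<^sub>C x}))"

definition singular_values :: "('a::complex_hilbert \<Rightarrow> 'a) \<Rightarrow> nat \<Rightarrow> real" where
  "singular_values T = eigenvalues (modulus T)"


section \<open>Weak Lorentz ideals and their traces\<close>

definition RV_minus_one :: "(real \<Rightarrow> real) \<Rightarrow> bool" where
  "RV_minus_one g \<longleftrightarrow>
     continuous_on {0..} g \<and> (\<forall>t\<ge>0. 0 < g t) \<and>
     (\<exists>a\<ge>0. mono_on {a..} g \<or> antimono_on {a..} g) \<and>
     (\<forall>l>0. ((\<lambda>t. g (l * t) / g t) \<longlongrightarrow> inverse l) at_top)"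

definition weak_lorentz :: "(real \<Rightarrow> real) \<Rightarrow> ('a::complex_hilbert \<Rightarrow> 'a) set" where
  "weak_lorentz g = {T. compact_op T \<and> singular_values T \<in> O(\<lambda>j. g (real j))}"

text \<open>A functional on the ideal is a function on all operators of which only the values on the
  ideal matter.\<close>

definition is_trace :: "(real \<Rightarrow> real) \<Rightarrow> (('a::complex_hilbert \<Rightarrow> 'a) \<Rightarrow> complex) \<Rightarrow> bool" where
  "is_trace g \<phi> \<longleftrightarrow>
     (\<forall>S\<in>weak_lorentz g. \<forall>T\<in>weak_lorentz g. \<phi> (\<lambda>x. S x + T x) = \<phi> S + \<phi> T) \<and>
     (\<forall>c. \<forall>T\<in>weak_lorentz g. \<phi> (\<lambda>x. c *\<^sub>C T x) = c * \<phi> T) \<and>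
     (\<forall>A. \<forall>T\<in>weak_lorentz g. bounded_clinear A \<longrightarrow> \<phi> (\<lambda>x. A (T x) - T (A x)) = 0)"

definition is_model_operator :: "(real \<Rightarrow> real) \<Rightarrow> ('a::complex_hilbert \<Rightarrow> 'a) \<Rightarrow> bool" where
  "is_model_operator g A \<longleftrightarrow> bounded_clinear A \<and>
     (\<exists>\<xi>. orthonormal_basis \<xi> \<and> (\<forall>j. A (\<xi> j) = complex_of_real (g (real j)) *\<^sub>C \<xi> j))"

text \<open>All model operators for \<open>g\<close> are unitarily equivalent, so a trace takes the same value on each
  of them.\<close>

definition is_normalized_trace ::
    "(real \<Rightarrow> real) \<Rightarrow> (('a::complex_hilbert \<Rightarrow> 'a) \<Rightarrow> complex) \<Rightarrow> bool" where
  "is_normalized_trace g \<phi> \<longleftrightarrow> is_trace g \<phi> \<and> (\<forall>A. is_model_operator g A \<longrightarrow> \<phi> A = 1)"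

definition hypermeasurable :: "(real \<Rightarrow> real) \<Rightarrow> ('a::complex_hilbert \<Rightarrow> 'a) \<Rightarrow> bool" where
  "hypermeasurable g T \<longleftrightarrow> T \<in> weak_lorentz g \<and>
     (\<forall>\<phi> \<psi>. is_normalized_trace g \<phi> \<and> is_normalized_trace g \<psi> \<longrightarrow> \<phi> T = \<psi> T)"

end

theory Submission
  imports Defs
begin

text \<open>
  All normalised traces take the value \<open>c\<^sup>+ - c\<^sup>-\<close> on \<open>T\<close>. To see this, split \<open>T = T\<^sup>+ - T\<^sup>-\<close>. By the spectral
  theorem each part is diagonal along an orthonormal sequence, with its ordered eigenvalues as entries.
  A trace does not see along which orthonormal sequence an operator is diagonal
  (\<open>trace_schmidt_unitarily_invariant\<close>), so its value on a part is its value on the diagonal operator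
  with entries \<open>g(j) (c + r j)\<close> in a fixed orthonormal basis, where \<open>c = c\<^sup>\<plusminus>\<close> and \<open>r = O(\<epsilon>)\<close>.
  The first summand is \<open>c\<close> times the model operator, and it remains to show that a trace vanishes on the
  diagonal operator with entries \<open>a j = g(j) r j\<close>, where \<open>\<bar>a j\<bar>\<close> is at most a constant times \<open>\<epsilon>(j) g(j)\<close> for large \<open>j\<close>.

  For this let \<open>y\<close> solve \<open>y j = a j + y (j div 2) / 2\<close>. Each index \<open>m\<close> is \<open>j div 2\<close> for \<open>j = 2 m\<close> and
  \<open>j = 2 m + 1\<close>, so the diagonal operator with entries \<open>y (j div 2)\<close> is the sum of two copies of the one
  with entries \<open>y j\<close>, along the even and along the odd basis vectors (\<open>trace_schmidt_doubling\<close>). If the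
  operator with entries \<open>y\<close> belongs to the ideal, this gives \<open>\<phi>(y) = \<phi>(a) + (1/2) \<cdot> 2 \<phi>(y)\<close>, that is,
  \<open>\<phi>(a) = 0\<close>.

  It remains to see that \<open>y = O(g)\<close>. One has \<open>j y j = \<Sum>k. (j / 2\<^sup>k) a (j div 2\<^sup>k)\<close>. Since \<open>\<bar>a\<bar>\<close> is dominated
  by a multiple of \<open>\<epsilon> g\<close>, which eventually decreases, the \<open>k\<close>-th term is, as long as \<open>j div 2\<^sup>k\<close> is
  large and up to rounding, bounded by a constant times the integral of \<open>\<epsilon> g\<close> from \<open>j / 2\<^sup>k\<^sup>+\<^sup>1\<close> to
  \<open>j / 2\<^sup>k\<close>. Altogether \<open>j \<bar>y j\<bar>\<close> is bounded by a constant plus a multiple of the integral of \<open>\<epsilon> g\<close> up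
  to \<open>j\<close>, which is \<open>O(j g(j))\<close>; the constant is harmless as \<open>1/t = O(g(t))\<close>
  (\<open>tree_sum_bound\<close>, \<open>tree_sum_bigo\<close>).

  The operators are handled as Schmidt series \<open>\<Sum>n. c n \<langle>u n, x\<rangle> v n\<close>. The modulus and the eigenvalue
  sequence are definite descriptions, which denote because a positive operator is determined by its
  square (\<open>modulus_schmidt\<close>), a non-increasing sequence is determined by its multiplicities
  (\<open>eigenvalues_eqI\<close>), and compact symmetric operators are diagonalisable
  (\<open>compact_symmetric_spectral_theorem\<close>). The singular values of a Schmidt series rearrange \<open>\<bar>c\<bar>\<close> in
  decreasing order, so its membership in the ideal can be read off from \<open>c = O(g)\<close>
  (\<open>schmidt_in_weak_lorentz\<close>).
\<close>

section \<open>Inner products\<close>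

lemma cinner_add_left: "cinner (x + y) z = cinner x z + cinner y z" for x :: "'a::complex_hilbert"
  by (metis cinner_add_right cinner_commute complex_cnj_add)

lemma cinner_scaleC_left: "cinner (c *\<^sub>C x) y = cnj c * cinner x y" for x :: "'a::complex_hilbert"
  by (metis cinner_commute cinner_scaleC_right complex_cnj_mult)

lemma norm_scaleC: "norm (c *\<^sub>C x) = cmod c * norm x" for x :: "'a::complex_hilbert"
proof -
  have "complex_of_real ((norm (c *\<^sub>C x))\<^sup>2) = c * cnj c * complex_of_real ((norm x)\<^sup>2)"
    unfolding cinner_self[symmetric] cinner_scaleC_left cinner_scaleC_right by simp
  also have "\<dots> = complex_of_real ((cmod c * norm x)\<^sup>2)"
    by (simp add: power_mult_distrib flip: complex_norm_square)
  finally show ?thesis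
    by (metis abs_norm_cancel norm_ge_zero of_real_eq_iff power2_eq_imp_eq zero_le_mult_iff)
qed

lemma cinner_scaleR_right: "cinner x (r *\<^sub>R y) = of_real r * cinner x y" for x :: "'a::complex_hilbert"
  by (simp add: scaleR_scaleC cinner_scaleC_right)

lemma cinner_scaleR_left: "cinner (r *\<^sub>R x) y = of_real r * cinner x y" for x :: "'a::complex_hilbert"
  by (simp add: scaleR_scaleC cinner_scaleC_left)

lemma cinner_diff_right: "cinner x (y - z) = cinner x y - cinner x z" for x :: "'a::complex_hilbert"
  by (metis add_diff_cancel cinner_add_right diff_add_cancel)

lemma cinner_diff_left: "cinner (x - y) z = cinner x z - cinner y z" for x :: "'a::complex_hilbert"
  by (metis add_diff_cancel cinner_add_left diff_add_cancel)

lemma norm_diff_squared: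
  "(norm (x - y))\<^sup>2 = (norm x)\<^sup>2 - 2 * Re (cinner x y) + (norm y)\<^sup>2" for x :: "'a::complex_hilbert"
proof -
  have "(norm (x - y))\<^sup>2 = Re (cinner (x - y) (x - y))"
    by (simp add: cinner_self)
  also have "\<dots> = Re (cinner x x) - Re (cinner x y) - Re (cinner y x) + Re (cinner y y)"
    by (simp add: cinner_diff_left cinner_diff_right)
  also have "Re (cinner y x) = Re (cinner x y)"
    by (subst cinner_commute) simp
  finally show ?thesis
    by (simp add: cinner_self)
qed

lemma cinner_Cauchy_Schwarz: "cmod (cinner x y) \<le> norm x * norm y" for x :: "'a::complex_hilbert"
proof (cases "y = 0")
  case True
  then show ?thesis
    using cinner_scaleC_right[of x 0 y] by (simp add: complex_vector.scale_zero_left)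
next
  case False
  define c where "c = cnj (cinner x y) / of_real ((norm y)\<^sup>2)"
  have "Re (cinner x (c *\<^sub>C y)) = (cmod (cinner x y))\<^sup>2 / (norm y)\<^sup>2"
    unfolding c_def cinner_scaleC_right times_divide_eq_left mult.commute[of "cnj _"] complex_norm_square[symmetric]
    by (simp flip: of_real_divide of_real_power)
  moreover have "(norm (c *\<^sub>C y))\<^sup>2 = (cmod (cinner x y))\<^sup>2 / (norm y)\<^sup>2"
    using False by (simp add: c_def norm_scaleC norm_divide norm_mult power2_eq_square)
  ultimately have "0 \<le> (norm x)\<^sup>2 - (cmod (cinner x y))\<^sup>2 / (norm y)\<^sup>2"
    using norm_diff_squared[of x "c *\<^sub>C y"] by (smt (verit) zero_le_power2)
  then have "(cmod (cinner x y))\<^sup>2 \<le> (norm x * norm y)\<^sup>2"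
    using False by (simp add: field_simps power_mult_distrib)
  then show ?thesis
    by (rule power2_le_imp_le) simp
qed

interpretation cinner: bounded_bilinear "cinner :: 'a::complex_hilbert \<Rightarrow> 'a \<Rightarrow> complex"
  by unfold_locales
    (auto simp: cinner_add_left cinner_add_right cinner_scaleR_left cinner_scaleR_right scaleR_conv_of_real
      intro!: exI[of _ 1] cinner_Cauchy_Schwarz)

interpretation scaleC: bounded_bilinear "scaleC :: complex \<Rightarrow> 'a::complex_hilbert \<Rightarrow> 'a"
  by unfold_locales
    (auto simp: scaleC_add_left scaleC_add_right scaleR_scaleC scaleC_scaleC scaleR_conv_of_real mult.commute
       norm_scaleC
      intro!: exI[of _ 1])

lemma cinner_eqI:
  assumes "\<And>z. cinner z x = cinner z y"
  shows "x = (y :: 'a::complex_hilbert)"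
proof -
  have "cinner (x - y) (x - y) = 0"
    by (simp add: cinner_diff_right assms)
  then show ?thesis
    by (simp add: cinner_self)
qed

lemma cadjoint_eqI:
  assumes "\<And>x y. cinner (T x) y = cinner x (S y)"
  shows "cadjoint T = S"
  unfolding cadjoint_def
proof (rule the_equality)
  show "\<forall>x y. cinner (T x) y = cinner x (S y)"
    using assms by simp
next
  fix R assume "\<forall>x y. cinner (T x) y = cinner x (R y)"
  then show "R = S"
    using assms by (intro ext cinner_eqI) metis
qed

lemma bounded_clinearD:
  assumes "bounded_clinear T"
  shows "bounded_linear T" "T (c *\<^sub>C x) = c *\<^sub>C T x"
  using assms by (auto simp: bounded_clinear_def)

lemma bounded_clinear_add: "bounded_clinear T \<Longrightarrow> T (x + y) = T x + T y"
  and bounded_clinear_diff: "bounded_clinear T \<Longrightarrow> T (x - y) = T x - T y"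
  and bounded_clinear_zero: "bounded_clinear T \<Longrightarrow> T 0 = 0"
  by (auto dest!: bounded_clinearD(1) simp: linear_simps)

subsection \<open>Positive operators\<close>

text \<open>Positivity makes the quadratic form \<open>cinner z (P z)\<close> real; polarisation with \<open>z = x + y\<close> and
  \<open>z = x + \<i> y\<close> turns this into symmetry.\<close>

lemma positive_op_symmetric:
  assumes "positive_op P"
  shows "cinner (P x) y = cinner x (P y)"
proof -
  have P: "bounded_clinear P" and real: "Im (cinner z (P z)) = 0" for z
    using assms by (auto simp: positive_op_def complex_nonneg_Reals_iff)
  note simps = bounded_clinear_add[OF P] bounded_clinearD(2)[OF P] cinner_add_left cinner_add_right
    cinner_scaleC_left cinner_scaleC_right
  have "Im (cinner x (P y)) + Im (cinner y (P x)) = 0"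
    using real[of "x + y"] real[of x] real[of y] by (simp add: simps)
  moreover have "Re (cinner x (P y)) - Re (cinner y (P x)) = 0"
    using real[of "x + \<i> *\<^sub>C y"] real[of x] real[of y] by (simp add: simps)
  ultimately have "cinner x (P y) = cnj (cinner y (P x))"
    by (simp add: complex_eq_iff)
  then show ?thesis
    by (metis cinner_commute)
qed

lemma positive_op_shift_injective:
  assumes "positive_op P" "0 < t" "P x + of_real t *\<^sub>C x = 0"
  shows "x = 0"
proof -
  have "cinner x (P x) + of_real t * of_real ((norm x)\<^sup>2) = 0"
    using arg_cong[OF assms(3), of "cinner x"]
    by (simp add: cinner_add_right cinner_scaleC_right cinner_self cinner.zero_right)
  then have "Re (cinner x (P x)) + t * (norm x)\<^sup>2 = 0"
    by (metis Re_complex_of_real of_real_mult plus_complex.sel(1) zero_complex.sel(1))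
  moreover have "0 \<le> Re (cinner x (P x))"
    using assms(1) by (auto simp: positive_op_def complex_nonneg_Reals_iff)
  ultimately have "t * (norm x)\<^sup>2 = 0"
    using assms(2) by (smt (verit) mult_nonneg_nonneg zero_le_power2)
  then show ?thesis
    using assms(2) by simp
qed

text \<open>On an eigenvector of \<open>P\<^sup>2\<close> a positive operator acts as the positive root of the eigenvalue:
  \<open>P\<^sup>2 - t\<^sup>2\<close> factors through \<open>P + t\<close>, which is injective.\<close>

lemma positive_op_sqrt_eigenvector:
  assumes "positive_op P" "0 \<le> t" "P (P x) = of_real (t\<^sup>2) *\<^sub>C x"
  shows "P x = of_real t *\<^sub>C x"
proof (cases "t = 0")
  case True
  have "cinner (P x) (P x) = 0"
    using assms(3) True by (simp add: positive_op_symmetric[OF assms(1)] cinner.zero_right)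
  then show ?thesis
    using True by (simp add: cinner_self)
next
  case False
  have P: "bounded_clinear P"
    using assms(1) by (simp add: positive_op_def)
  have shift: "P (P x - of_real t *\<^sub>C x) + of_real t *\<^sub>C (P x - of_real t *\<^sub>C x) = 0"
    unfolding bounded_clinear_diff[OF P] bounded_clinearD(2)[OF P] assms(3)
      complex_vector.scale_right_diff_distrib by (simp add: power2_eq_square scaleC_scaleC)
  have "0 < t"
    using False assms(2) by simp
  then have "P x - of_real t *\<^sub>C x = 0"
    by (rule positive_op_shift_injective[OF assms(1) _ shift])
  then show ?thesis
    by simp
qed

section \<open>Orthonormal sequences\<close>

text \<open>The index set \<open>A\<close> is there for the stages of a recursive construction, at which only an initial
  segment of the sequence has been chosen.\<close>

definition orthonormal_on :: "nat set \<Rightarrow> (nat \<Rightarrow> 'a::complex_hilbert) \<Rightarrow> bool" where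
  "orthonormal_on A u \<longleftrightarrow> (\<forall>i\<in>A. \<forall>j\<in>A. cinner (u i) (u j) = (if i = j then 1 else 0))"

abbreviation "orthonormal \<equiv> orthonormal_on UNIV"

lemma orthonormal_on_subset: "orthonormal_on A u \<Longrightarrow> B \<subseteq> A \<Longrightarrow> orthonormal_on B u"
  unfolding orthonormal_on_def by blast

lemma orthonormal_compose: "orthonormal u \<Longrightarrow> inj f \<Longrightarrow> orthonormal (\<lambda>i. u (f i))"
  by (auto simp: orthonormal_on_def inj_eq)

lemma orthonormal_cinner: "orthonormal u \<Longrightarrow> cinner (u i) (u j) = (if i = j then 1 else 0)"
  by (simp add: orthonormal_on_def)

lemma orthonormal_on_norm:
  assumes "orthonormal_on A u" "i \<in> A"
  shows "norm (u i) = 1"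
proof -
  have "complex_of_real ((norm (u i))\<^sup>2) = complex_of_real 1"
    unfolding cinner_self[symmetric] using assms by (simp add: orthonormal_on_def)
  then have "(norm (u i))\<^sup>2 = 1\<^sup>2"
    unfolding of_real_eq_iff by simp
  then show ?thesis
    by (rule power2_eq_imp_eq) auto
qed

lemma cinner_orthonormal_sum:
  assumes "orthonormal_on A u" "finite A" "k \<in> A"
  shows "cinner (u k) (\<Sum>i\<in>A. a i *\<^sub>C u i) = a k"
proof -
  have "cinner (u k) (\<Sum>i\<in>A. a i *\<^sub>C u i) = (\<Sum>i\<in>A. if k = i then a i else 0)"
    unfolding cinner.sum_right cinner_scaleC_right
    using assms by (intro sum.cong) (auto simp: orthonormal_on_def)
  then show ?thesis
    using assms by simp
qed

lemma norm_orthonormal_sum: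
  assumes "orthonormal_on A u" "finite A"
  shows "(norm (\<Sum>i\<in>A. a i *\<^sub>C u i))\<^sup>2 = (\<Sum>i\<in>A. (cmod (a i))\<^sup>2)"
proof -
  let ?s = "\<Sum>i\<in>A. a i *\<^sub>C u i"
  have "complex_of_real ((norm ?s)\<^sup>2) = (\<Sum>i\<in>A. cnj (a i) * cinner (u i) ?s)"
    unfolding cinner_self[symmetric] by (subst cinner.sum_left) (simp add: cinner_scaleC_left)
  also have "\<dots> = (\<Sum>i\<in>A. cnj (a i) * a i)"
    using assms by (intro sum.cong) (auto simp: cinner_orthonormal_sum)
  also have "\<dots> = complex_of_real (\<Sum>i\<in>A. (cmod (a i))\<^sup>2)"
    by (simp only: complex_norm_square mult.commute of_real_sum)
  finally show ?thesis
    by (simp only: of_real_eq_iff)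
qed

lemma orthogonal_residual:
  assumes "orthonormal_on A u" "finite A" "k \<in> A"
  shows "cinner (u k) (x - (\<Sum>i\<in>A. cinner (u i) x *\<^sub>C u i)) = 0"
  by (simp add: cinner_diff_right cinner_orthonormal_sum[OF assms])

lemma norm_orthogonal_residual:
  assumes "orthonormal_on A u" "finite A"
  shows "(norm (x - (\<Sum>i\<in>A. cinner (u i) x *\<^sub>C u i)))\<^sup>2
           = (norm x)\<^sup>2 - (\<Sum>i\<in>A. (cmod (cinner (u i) x))\<^sup>2)"
proof -
  let ?s = "\<Sum>i\<in>A. cinner (u i) x *\<^sub>C u i"
  have "cinner x ?s = (\<Sum>i\<in>A. cinner (u i) x * cnj (cinner (u i) x))"
    by (simp add: cinner.sum_right cinner_scaleC_right flip: cinner_commute)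
  also have "\<dots> = complex_of_real (\<Sum>i\<in>A. (cmod (cinner (u i) x))\<^sup>2)"
    by (simp only: complex_norm_square[symmetric] of_real_sum)
  finally show ?thesis
    using norm_diff_squared[of x ?s] norm_orthonormal_sum[OF assms, of "\<lambda>i. cinner (u i) x"] by simp
qed

lemma Bessel:
  assumes "orthonormal_on A u" "finite A"
  shows "(\<Sum>i\<in>A. (cmod (cinner (u i) x))\<^sup>2) \<le> (norm x)\<^sup>2"
  using norm_orthogonal_residual[OF assms, of x] by (smt (verit) zero_le_power2)

lemma Riesz_Fischer:
  assumes "orthonormal u" "summable (\<lambda>i. (cmod (a i))\<^sup>2)"
  shows "summable (\<lambda>i. a i *\<^sub>C u i)"
  unfolding summable_Cauchy
proof (intro allI impI)
  fix e :: real assume "0 < e"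
  then obtain N where N: "\<And>m n. m \<ge> N \<Longrightarrow> norm (\<Sum>i=m..<n. (cmod (a i))\<^sup>2) < e\<^sup>2"
    using assms(2) unfolding summable_Cauchy by (metis zero_less_power)
  show "\<exists>N. \<forall>m\<ge>N. \<forall>n. norm (\<Sum>i=m..<n. a i *\<^sub>C u i) < e"
  proof (intro exI[of _ N] allI impI)
    fix m n assume "m \<ge> N"
    then have "(norm (\<Sum>i=m..<n. a i *\<^sub>C u i))\<^sup>2 < e\<^sup>2"
      using N[of m n] norm_orthonormal_sum[OF orthonormal_on_subset[OF assms(1)], of "{m..<n}" a]
      by (simp add: sum_nonneg)
    then show "norm (\<Sum>i=m..<n. a i *\<^sub>C u i) < e"
      using \<open>0 < e\<close> by (simp add: power2_less_imp_less)
  qed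
qed

lemma cinner_suminf_orthonormal:
  assumes "summable (\<lambda>i. a i *\<^sub>C u i)" "orthonormal u"
  shows "cinner (u k) (\<Sum>i. a i *\<^sub>C u i) = a k"
proof -
  have "cinner (u k) (\<Sum>i. a i *\<^sub>C u i) = (\<Sum>i. cinner (u k) (a i *\<^sub>C u i))"
    using bounded_linear.suminf[OF cinner.bounded_linear_right assms(1)] by simp
  also have "\<dots> = (\<Sum>i. if i = k then a i else 0)"
    using assms(2) by (intro suminf_cong) (auto simp: cinner_scaleC_right orthonormal_on_def)
  also have "\<dots> = a k"
    by (rule sums_unique[symmetric], rule sums_single)
  finally show ?thesis .
qed

section \<open>Operators given by a Schmidt series\<close>

text \<open>With \<open>u = v\<close> this is a diagonal operator, and with \<open>c = 1\<close> the partial isometry that carries \<open>u n\<close> to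
  \<open>v n\<close>. The orthonormal sequences need not be complete, so that compositions, adjoints and moduli of
  such operators are again of this form.\<close>

definition schmidt :: "(nat \<Rightarrow> real) \<Rightarrow> (nat \<Rightarrow> 'a) \<Rightarrow> (nat \<Rightarrow> 'a) \<Rightarrow> 'a \<Rightarrow> 'a::complex_hilbert" where
  "schmidt c u v x = (\<Sum>n. (complex_of_real (c n) * cinner (u n) x) *\<^sub>C v n)"

lemma schmidt_coefficients_partial_sum:
  assumes "orthonormal u" "\<And>n. \<bar>c n\<bar> \<le> K" "finite A"
  shows "(\<Sum>n\<in>A. (cmod (complex_of_real (c n) * cinner (u n) x))\<^sup>2) \<le> (K * norm x)\<^sup>2"
proof -
  have "(\<Sum>n\<in>A. (cmod (complex_of_real (c n) * cinner (u n) x))\<^sup>2)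
          \<le> (\<Sum>n\<in>A. K\<^sup>2 * (cmod (cinner (u n) x))\<^sup>2)"
    using assms(2) by (intro sum_mono) (simp add: norm_mult power_mult_distrib mult_right_mono abs_le_square_iff[symmetric] order_trans[OF _ abs_ge_self])
  also have "\<dots> \<le> K\<^sup>2 * (norm x)\<^sup>2"
    unfolding sum_distrib_left[symmetric]
    using assms by (intro mult_left_mono Bessel) (auto intro: orthonormal_on_subset)
  finally show ?thesis
    by (simp add: power_mult_distrib)
qed

lemma schmidt_coefficients_summable:
  assumes "orthonormal u" "Bseq c"
  shows "summable (\<lambda>n. (cmod (complex_of_real (c n) * cinner (u n) x))\<^sup>2)"
proof -
  obtain K where "\<And>n. \<bar>c n\<bar> \<le> K"
    using assms(2) by (auto simp: Bseq_def)
  then show ?thesis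
    by (intro bounded_imp_summable[where B = "(K * norm x)\<^sup>2"] schmidt_coefficients_partial_sum assms) auto
qed

lemma schmidt_sums:
  assumes "orthonormal u" "orthonormal v" "Bseq c"
  shows "(\<lambda>n. (complex_of_real (c n) * cinner (u n) x) *\<^sub>C v n) sums schmidt c u v x"
  unfolding schmidt_def
  by (intro summable_sums Riesz_Fischer schmidt_coefficients_summable assms)

lemma cinner_schmidt:
  assumes "orthonormal u" "orthonormal v" "Bseq c"
  shows "cinner (v k) (schmidt c u v x) = of_real (c k) * cinner (u k) x"
  unfolding schmidt_def
  using assms by (intro cinner_suminf_orthonormal sums_summable[OF schmidt_sums])

lemma norm_schmidt_le:
  assumes "orthonormal u" "orthonormal v" "\<And>n. \<bar>c n\<bar> \<le> K"
  shows "norm (schmidt c u v x) \<le> K * norm x"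
proof (rule LIMSEQ_le_const2)
  have "Bseq c"
    using assms(3) by (intro BseqI'[of _ K]) auto
  then show "(\<lambda>n. norm (\<Sum>i<n. (complex_of_real (c i) * cinner (u i) x) *\<^sub>C v i)) \<longlonglongrightarrow> norm (schmidt c u v x)"
    using schmidt_sums[OF assms(1,2)] unfolding sums_def by (intro tendsto_norm) auto
  have "0 \<le> K"
    using assms(3)[of 0] by linarith
  have "norm (\<Sum>i<n. (complex_of_real (c i) * cinner (u i) x) *\<^sub>C v i) \<le> K * norm x" for n
  proof (rule power2_le_imp_le)
    show "(norm (\<Sum>i<n. (complex_of_real (c i) * cinner (u i) x) *\<^sub>C v i))\<^sup>2 \<le> (K * norm x)\<^sup>2"
      using assms by (subst norm_orthonormal_sum)
        (auto intro: orthonormal_on_subset schmidt_coefficients_partial_sum)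
  qed (use \<open>0 \<le> K\<close> in simp)
  then show "\<exists>N. \<forall>n\<ge>N. norm (\<Sum>i<n. (complex_of_real (c i) * cinner (u i) x) *\<^sub>C v i) \<le> K * norm x"
    by blast
qed

lemma bounded_clinearI:
  assumes "\<And>x y. T (x + y) = T x + T y" "\<And>c x. T (c *\<^sub>C x) = c *\<^sub>C T x" "\<And>x. norm (T x) \<le> K * norm x"
  shows "bounded_clinear T"
  unfolding bounded_clinear_def
  using assms by (auto intro!: bounded_linear_intro[of _ K] simp: scaleR_scaleC mult.commute)

lemma bounded_clinear_schmidt:
  assumes "orthonormal u" "orthonormal v" "Bseq c"
  shows "bounded_clinear (schmidt c u v)"
proof -
  note sums = schmidt_sums[OF assms]
  obtain K where K: "\<And>n. \<bar>c n\<bar> \<le> K"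
    using assms(3) by (auto simp: Bseq_def)
  show ?thesis
  proof (rule bounded_clinearI)
    fix x y
    have "(\<lambda>n. (complex_of_real (c n) * cinner (u n) (x + y)) *\<^sub>C v n) sums (schmidt c u v x + schmidt c u v y)"
      using sums_add[OF sums[of x] sums[of y]] by (simp add: cinner_add_right distrib_left scaleC_add_left)
    then show "schmidt c u v (x + y) = schmidt c u v x + schmidt c u v y"
      by (rule sums_unique2[OF sums])
  next
    fix k x
    have "(\<lambda>n. (complex_of_real (c n) * cinner (u n) (k *\<^sub>C x)) *\<^sub>C v n) sums (k *\<^sub>C schmidt c u v x)"
      using bounded_linear.sums[OF scaleC.bounded_linear_right sums[of x], of k]
      by (simp add: cinner_scaleC_right scaleC_scaleC mult.left_commute)
    then show "schmidt c u v (k *\<^sub>C x) = k *\<^sub>C schmidt c u v x"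
      by (rule sums_unique2[OF sums])
  next
    fix x show "norm (schmidt c u v x) \<le> K * norm x"
      by (rule norm_schmidt_le[OF assms(1,2) K])
  qed
qed

lemma schmidt_add:
  assumes "orthonormal u" "orthonormal v" "Bseq c" "Bseq d"
  shows "schmidt (\<lambda>n. c n + d n) u v = (\<lambda>x. schmidt c u v x + schmidt d u v x)"
proof
  fix x
  have "(\<lambda>n. (complex_of_real (c n + d n) * cinner (u n) x) *\<^sub>C v n) sums (schmidt c u v x + schmidt d u v x)"
    using sums_add[OF schmidt_sums[OF assms(1,2,3)] schmidt_sums[OF assms(1,2,4)], of x x]
    by (simp add: distrib_right scaleC_add_left)
  then show "schmidt (\<lambda>n. c n + d n) u v x = schmidt c u v x + schmidt d u v x"
    unfolding schmidt_def[of "\<lambda>n. c n + d n"] by (rule sums_unique[symmetric])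
qed

lemma schmidt_scale:
  assumes "orthonormal u" "orthonormal v" "Bseq c"
  shows "schmidt (\<lambda>n. k * c n) u v = (\<lambda>x. complex_of_real k *\<^sub>C schmidt c u v x)"
proof
  fix x
  have "(\<lambda>n. (complex_of_real (k * c n) * cinner (u n) x) *\<^sub>C v n) sums (complex_of_real k *\<^sub>C schmidt c u v x)"
    using bounded_linear.sums[OF scaleC.bounded_linear_right schmidt_sums[OF assms], of "of_real k" x]
    by (simp add: scaleC_scaleC mult.assoc)
  then show "schmidt (\<lambda>n. k * c n) u v x = complex_of_real k *\<^sub>C schmidt c u v x"
    unfolding schmidt_def[of "\<lambda>n. k * c n"] by (rule sums_unique[symmetric])
qed

lemma schmidt_compose:
  assumes "orthonormal u" "orthonormal v" "Bseq d"
  shows "schmidt c v w (schmidt d u v x) = schmidt (\<lambda>n. c n * d n) u w x"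
  unfolding schmidt_def[of c] schmidt_def[of "\<lambda>n. c n * d n"]
  by (simp add: cinner_schmidt[OF assms] mult.assoc)

lemma schmidt_orthogonal: "(\<And>n. cinner (u n) x = 0) \<Longrightarrow> schmidt c u v x = 0"
  by (simp add: schmidt_def)

lemma schmidt_basis:
  assumes "orthonormal u"
  shows "schmidt c u v (u m) = complex_of_real (c m) *\<^sub>C v m"
proof -
  have "(\<lambda>n. (complex_of_real (c n) * cinner (u n) (u m)) *\<^sub>C v n)
          = (\<lambda>n. if n = m then complex_of_real (c n) *\<^sub>C v n else 0)"
    using assms by (auto simp: orthonormal_on_def)
  then show ?thesis
    unfolding schmidt_def by (simp add: sums_unique[symmetric, OF sums_single])
qed

lemma schmidt_adjoint:
  assumes "orthonormal u" "orthonormal v" "Bseq c"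
  shows "cinner (schmidt c u v x) y = cinner x (schmidt c v u y)"
proof (rule sums_unique2)
  show "(\<lambda>n. cinner ((complex_of_real (c n) * cinner (u n) x) *\<^sub>C v n) y) sums cinner (schmidt c u v x) y"
    by (rule bounded_linear.sums[OF cinner.bounded_linear_left schmidt_sums[OF assms]])
  have "cinner ((complex_of_real (c n) * cinner (u n) x) *\<^sub>C v n) y
      = cinner x ((complex_of_real (c n) * cinner (v n) y) *\<^sub>C u n)" for n
    by (simp add: cinner_scaleC_left cinner_scaleC_right flip: cinner_commute)
  then show "(\<lambda>n. cinner ((complex_of_real (c n) * cinner (u n) x) *\<^sub>C v n) y) sums cinner x (schmidt c v u y)"
    using bounded_linear.sums[OF cinner.bounded_linear_right schmidt_sums[OF assms(2,1,3)], of x y] by simp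
qed

lemma cadjoint_schmidt:
  assumes "orthonormal u" "orthonormal v" "Bseq c"
  shows "cadjoint (schmidt c u v) = schmidt c v u"
  by (intro cadjoint_eqI schmidt_adjoint assms)

lemma positive_op_schmidt:
  assumes "orthonormal u" "Bseq c" "\<And>n. 0 \<le> c n"
  shows "positive_op (schmidt c u u)"
  unfolding positive_op_def
proof (intro conjI allI)
  fix x
  have "(\<lambda>n. cinner x ((complex_of_real (c n) * cinner (u n) x) *\<^sub>C u n)) sums cinner x (schmidt c u u x)"
    by (rule bounded_linear.sums[OF cinner.bounded_linear_right schmidt_sums[OF assms(1,1,2)]])
  moreover have "cinner x ((complex_of_real (c n) * cinner (u n) x) *\<^sub>C u n)
      = complex_of_real (c n * (cmod (cinner (u n) x))\<^sup>2)" for n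
    by (subst cinner_scaleC_right, subst (2) cinner_commute)
      (simp only: mult.assoc complex_norm_square[symmetric] of_real_mult)
  ultimately have *: "(\<lambda>n. complex_of_real (c n * (cmod (cinner (u n) x))\<^sup>2)) sums cinner x (schmidt c u u x)"
    by simp
  have "0 \<le> Re (cinner x (schmidt c u u x))"
    by (rule sums_le[OF _ sums_zero sums_Re[OF *]]) (simp add: assms(3))
  moreover have "Im (cinner x (schmidt c u u x)) = 0"
    using sums_unique2[OF sums_Im[OF *]] by simp
  ultimately show "cinner x (schmidt c u u x) \<in> \<real>\<^sub>\<ge>\<^sub>0"
    by (simp add: complex_nonneg_Reals_iff)
qed (intro bounded_clinear_schmidt assms)

lemma schmidt_projection_residual:
  assumes "orthonormal u"
  shows "cinner (u n) (x - schmidt (\<lambda>_. 1) u u x) = 0"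
  using cinner_schmidt[OF assms assms, of "\<lambda>_. 1"] by (simp add: cinner_diff_right)

text \<open>Continuity extends the values of \<open>P\<close> on the sequence \<open>u\<close> to its closed span, and every vector is the
  sum of a vector of this span and one orthogonal to it.\<close>

lemma schmidt_eqI:
  assumes u: "orthonormal u" "orthonormal v" "Bseq c" and P: "bounded_clinear P"
    and basis: "\<And>n. P (u n) = complex_of_real (c n) *\<^sub>C v n"
    and orth: "\<And>x. (\<And>n. cinner (u n) x = 0) \<Longrightarrow> P x = 0"
  shows "P = schmidt c u v"
proof
  fix x
  let ?s = "schmidt (\<lambda>_. 1) u u x"
  have "(\<lambda>n. P ((complex_of_real 1 * cinner (u n) x) *\<^sub>C u n)) sums P ?s"
    by (intro bounded_linear.sums[OF bounded_clinearD(1)[OF P]] schmidt_sums u) auto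
  then have "(\<lambda>n. (complex_of_real (c n) * cinner (u n) x) *\<^sub>C v n) sums P ?s"
    by (simp add: bounded_clinearD(2)[OF P] basis scaleC_scaleC mult.commute)
  then have "P ?s = schmidt c u v x"
    using schmidt_sums[OF u] sums_unique2 by blast
  moreover have "P (x - ?s) = 0"
    by (intro orth schmidt_projection_residual u)
  ultimately show "P x = schmidt c u v x"
    by (simp add: bounded_clinear_diff[OF P])
qed

text \<open>The square \<open>X\<^sup>* X\<close> of the modulus is diagonal along \<open>u\<close>. Any positive root of it is determined on
  each \<open>u n\<close>, and on every vector orthogonal to all of them, by \<open>positive_op_sqrt_eigenvector\<close>; hence
  the definite description in the definition of the modulus denotes.\<close>

lemma modulus_schmidt:
  assumes u: "orthonormal u" "orthonormal v" "Bseq c"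
  shows "modulus (schmidt c u v) = schmidt (\<lambda>n. \<bar>c n\<bar>) u u"
  unfolding modulus_def
proof (rule the_equality)
  have abs: "Bseq (\<lambda>n. \<bar>c n\<bar>)"
    using u(3) by (simp add: Bseq_def)
  have square: "cadjoint (schmidt c u v) \<circ> schmidt c u v = schmidt (\<lambda>n. (\<bar>c n\<bar>)\<^sup>2) u u"
    by (rule ext) (simp add: cadjoint_schmidt[OF u] schmidt_compose[OF u] power2_eq_square)
  show "positive_op (schmidt (\<lambda>n. \<bar>c n\<bar>) u u) \<and>
      schmidt (\<lambda>n. \<bar>c n\<bar>) u u \<circ> schmidt (\<lambda>n. \<bar>c n\<bar>) u u = cadjoint (schmidt c u v) \<circ> schmidt c u v"
    unfolding square
    by (intro conjI positive_op_schmidt u abs ext)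
      (simp_all add: schmidt_compose[OF u(1,1) abs] power2_eq_square)
  fix P assume "positive_op P \<and> P \<circ> P = cadjoint (schmidt c u v) \<circ> schmidt c u v"
  then have pos: "positive_op P" and P: "bounded_clinear P"
    and PP: "P (P x) = schmidt (\<lambda>n. (\<bar>c n\<bar>)\<^sup>2) u u x" for x
    unfolding square by (auto simp: positive_op_def fun_eq_iff)
  show "P = schmidt (\<lambda>n. \<bar>c n\<bar>) u u"
  proof (rule schmidt_eqI[OF u(1,1) abs P])
    show "P (u n) = complex_of_real \<bar>c n\<bar> *\<^sub>C u n" for n
      by (rule positive_op_sqrt_eigenvector[OF pos]) (simp_all only: PP schmidt_basis[OF u(1)] abs_ge_zero)
  next
    fix x assume "\<And>n. cinner (u n) x = 0"
    then have "P (P x) = complex_of_real (0\<^sup>2) *\<^sub>C x"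
      by (simp add: PP schmidt_orthogonal)
    then have "P x = complex_of_real 0 *\<^sub>C x"
      by (intro positive_op_sqrt_eigenvector[OF pos]) auto
    then show "P x = 0"
      by simp
  qed
qed

lemma compact_orthonormal_box:
  fixes v :: "nat \<Rightarrow> 'a::complex_hilbert"
  shows "compact {\<Sum>n<N. a n *\<^sub>C v n |a. \<forall>n<N. cmod (a n) \<le> C}"
proof (induction N)
  case 0
  then show ?case by simp
next
  case (Suc N)
  let ?B = "{\<Sum>n<N. a n *\<^sub>C v n |a. \<forall>n<N. cmod (a n) \<le> C}"
  have "{\<Sum>n<Suc N. a n *\<^sub>C v n |a. \<forall>n<Suc N. cmod (a n) \<le> C}
      = {x + y |x y. x \<in> ?B \<and> y \<in> (\<lambda>z. z *\<^sub>C v N) ` cball 0 C}" (is "?L = ?R")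
  proof (intro equalityI subsetI)
    fix s assume "s \<in> ?L"
    then obtain a where "s = (\<Sum>n<N. a n *\<^sub>C v n) + a N *\<^sub>C v N" "\<forall>n<Suc N. cmod (a n) \<le> C"
      by auto
    then show "s \<in> ?R"
      by (force simp: less_Suc_eq)
  next
    fix s assume "s \<in> ?R"
    then obtain a z where "s = (\<Sum>n<N. a n *\<^sub>C v n) + z *\<^sub>C v N" "\<forall>n<N. cmod (a n) \<le> C" "cmod z \<le> C"
      by auto
    then show "s \<in> ?L"
      by (intro CollectI exI[of _ "a(N := z)"]) (auto simp: less_Suc_eq)
  qed
  moreover have "compact ((\<lambda>z. z *\<^sub>C v N) ` cball 0 C)"
    by (intro compact_continuous_image linear_continuous_on scaleC.bounded_linear_left) auto
  ultimately show ?case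
    using compact_sums[OF Suc] by simp
qed

text \<open>Cutting the series off after \<open>N\<close> terms changes the image of the unit ball by at most
  \<open>sup {\<bar>c n\<bar> | n \<ge> N}\<close>, and the image under the finite part lies in a compact box.\<close>

lemma compact_op_schmidt:
  assumes u: "orthonormal u" "orthonormal v" and c: "c \<longlonglongrightarrow> 0"
  shows "compact_op (schmidt c u v)"
proof -
  have Bc: "Bseq c"
    by (rule convergent_imp_Bseq[OF convergentI[OF c]])
  then obtain K where K: "\<And>n. \<bar>c n\<bar> \<le> K"
    by (auto simp: Bseq_def)
  let ?D = "schmidt c u v ` cball 0 1"
  have "\<exists>k. finite k \<and> closure ?D \<subseteq> (\<Union>x\<in>k. ball x e)" if "0 < e" for e :: real
  proof -
    from c \<open>0 < e\<close> obtain N where N: "\<And>n. n \<ge> N \<Longrightarrow> \<bar>c n\<bar> < e / 4"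
      unfolding lim_sequentially dist_real_def by (metis diff_zero divide_pos_pos zero_less_numeral)
    define box where "box = {\<Sum>n<N. a n *\<^sub>C v n |a. \<forall>n<N. cmod (a n) \<le> K}"
    have "compact box"
      unfolding box_def by (rule compact_orthonormal_box)
    then obtain k where k: "finite k" "box \<subseteq> (\<Union>x\<in>k. ball x (e / 2))"
      using \<open>0 < e\<close> unfolding compact_eq_totally_bounded by (meson half_gt_zero)
    have "?D \<subseteq> (\<Union>x\<in>k. cball x (3 * e / 4))"
    proof (intro subsetI, elim imageE)
      fix y x assume x: "x \<in> cball 0 1" and y: "y = schmidt c u v x"
      define d where "d = (\<lambda>n. if n < N then 0 else c n)"
      define s where "s = (\<Sum>n<N. (complex_of_real (c n) * cinner (u n) x) *\<^sub>C v n)"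
      have Bd: "\<bar>d n\<bar> \<le> e / 4" for n
        using N[of n] \<open>0 < e\<close> by (auto simp: d_def)
      then have "Bseq d"
        by (intro BseqI'[of _ "e/4"]) auto
      have "(\<lambda>n. (complex_of_real (c n) * cinner (u n) x) *\<^sub>C v n
                - (if n \<in> {..<N} then (complex_of_real (c n) * cinner (u n) x) *\<^sub>C v n else 0))
              sums (schmidt c u v x - s)"
        unfolding s_def by (intro sums_diff schmidt_sums u Bc sums_If_finite_set) auto
      moreover have "(\<lambda>n. (complex_of_real (c n) * cinner (u n) x) *\<^sub>C v n
                - (if n \<in> {..<N} then (complex_of_real (c n) * cinner (u n) x) *\<^sub>C v n else 0))
            = (\<lambda>n. (complex_of_real (d n) * cinner (u n) x) *\<^sub>C v n)"
        by (auto simp: d_def)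
      ultimately have "y - s = schmidt d u v x"
        using schmidt_sums[OF u \<open>Bseq d\<close>] sums_unique2 y by metis
      then have "norm (y - s) \<le> e / 4 * norm x"
        using norm_schmidt_le[OF u Bd] by simp
      also have "\<dots> \<le> e / 4"
        using x \<open>0 < e\<close> by (intro mult_left_le) auto
      finally have ys: "dist y s \<le> e / 4"
        by (simp add: dist_norm)
      have "cmod (complex_of_real (c n) * cinner (u n) x) \<le> K" for n
      proof -
        have "cmod (cinner (u n) x) \<le> norm (u n) * norm x"
          by (rule cinner_Cauchy_Schwarz)
        also have "\<dots> \<le> 1"
          using x by (simp add: orthonormal_on_norm[OF u(1)])
        finally show ?thesis
          using K[of n] mult_mono[of "\<bar>c n\<bar>" K "cmod (cinner (u n) x)" 1] by (simp add: norm_mult)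
      qed
      then have "s \<in> box"
        unfolding box_def s_def by (intro CollectI exI conjI) auto
      then obtain z where "z \<in> k" "dist z s < e / 2"
        using k(2) by auto
      then have "dist z y \<le> 3 * e / 4"
        using ys dist_triangle[of z y s] by (simp add: dist_commute)
      then show "y \<in> (\<Union>x\<in>k. cball x (3 * e / 4))"
        using \<open>z \<in> k\<close> by auto
    qed
    moreover have "closed (\<Union>x\<in>k. cball x (3 * e / 4))"
      using k(1) by auto
    ultimately have "closure ?D \<subseteq> (\<Union>x\<in>k. cball x (3 * e / 4))"
      by (rule closure_minimal)
    also have "\<dots> \<subseteq> (\<Union>x\<in>k. ball x e)"
      using \<open>0 < e\<close> by (force simp: subset_eq)
    finally show ?thesis
      using k(1) by blast
  qed
  then have "compact (closure ?D)"
    by (auto simp: compact_eq_totally_bounded complete_eq_closed)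
  then show ?thesis
    by (simp add: compact_op_def bounded_clinear_schmidt[OF u Bc])
qed

section \<open>Orthonormal bases and adjoints\<close>

lemma Gram_Schmidt_step:
  fixes u :: "nat \<Rightarrow> 'a::complex_hilbert"
  assumes u: "orthonormal_on {..<n} u" and y: "y \<notin> cspan (u ` {..<n})"
  obtains x where "norm x = 1" "\<And>k. k < n \<Longrightarrow> cinner (u k) x = 0" "y \<in> cspan (insert x (u ` {..<n}))"
proof -
  define s where "s = (\<Sum>i<n. cinner (u i) y *\<^sub>C u i)"
  define r where "r = y - s"
  define x where "x = complex_of_real (1 / norm r) *\<^sub>C r"
  have s: "s \<in> cspan (u ` {..<n})"
    unfolding s_def by (intro complex_vector.span_sum complex_vector.span_scale complex_vector.span_base) auto
  then have "r \<noteq> 0"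
    using y by (auto simp: r_def)
  show thesis
  proof
    show "norm x = 1"
      using \<open>r \<noteq> 0\<close> by (simp add: x_def norm_scaleC norm_divide)
    show "cinner (u k) x = 0" if "k < n" for k
      using orthogonal_residual[OF u, of k y] that
      by (simp add: x_def r_def s_def cinner_scaleC_right)
    have "y = complex_of_real (norm r) *\<^sub>C x + s"
      using \<open>r \<noteq> 0\<close> by (simp add: x_def scaleC_scaleC scaleC_one) (simp add: r_def)
    moreover have "s \<in> cspan (insert x (u ` {..<n}))"
      using s complex_vector.span_mono[of "u ` {..<n}" "insert x (u ` {..<n})"] by auto
    ultimately show "y \<in> cspan (insert x (u ` {..<n}))"
      by (metis complex_vector.span_add complex_vector.span_base complex_vector.span_scale insertI1)
  qed
qed

lemma orthonormal_on_lessThanI: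
  fixes u :: "nat \<Rightarrow> 'a::complex_hilbert"
  assumes "\<And>k. k < n \<Longrightarrow> norm (u k) = 1" "\<And>j k. k < n \<Longrightarrow> j < k \<Longrightarrow> cinner (u j) (u k) = 0"
  shows "orthonormal_on {..<n} u"
  unfolding orthonormal_on_def
proof (intro ballI)
  fix i j assume "i \<in> {..<n}" "j \<in> {..<n}"
  then show "cinner (u i) (u j) = (if i = j then 1 else 0)"
    using assms cinner_commute[of "u i" "u j"]
    by (cases i j rule: linorder_cases) (auto simp: cinner_self)
qed

text \<open>Bases and sequences of eigenvectors are both built by choosing one unit vector after another in the
  orthogonal complement of the earlier ones. The property \<open>P\<close> asked of the vector with index \<open>n\<close> may
  depend on the vectors with smaller indices only; this is what the second premise expresses.\<close>

lemma orthonormal_sequence_choice: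
  fixes P :: "(nat \<Rightarrow> 'a::complex_hilbert) \<Rightarrow> nat \<Rightarrow> 'a \<Rightarrow> bool"
  assumes step: "\<And>n u. orthonormal_on {..<n} u \<Longrightarrow> (\<And>k. k < n \<Longrightarrow> P u k (u k)) \<Longrightarrow>
      \<exists>x. norm x = 1 \<and> (\<forall>k<n. cinner (u k) x = 0) \<and> P u n x"
    and cong: "\<And>n u v x. (\<And>k. k < n \<Longrightarrow> u k = v k) \<Longrightarrow> P u n x = P v n x"
  shows "\<exists>u. orthonormal u \<and> (\<forall>n. P u n (u n))"
proof -
  define Q where "Q u n x \<longleftrightarrow> norm x = 1 \<and> (\<forall>k<n. cinner (u k) x = 0) \<and> P u n x" for u n x
  have "\<exists>u. \<forall>n. Q u n (u n)"
  proof (rule dependent_wf_choice[OF wf_less_than])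
    fix u v n x assume eq: "\<And>k. (k, n) \<in> less_than \<Longrightarrow> u k = (v k :: 'a)"
    show "Q u n x = Q v n x"
      using cong[of n u v x] eq by (auto simp: Q_def)
  next
    fix n u assume "\<And>k. (k, n) \<in> less_than \<Longrightarrow> Q u k (u k)"
    then have Q: "Q u k (u k)" if "k < n" for k
      using that by auto
    have "orthonormal_on {..<n} u"
      using Q by (intro orthonormal_on_lessThanI) (auto simp: Q_def)
    then show "\<exists>x. Q u n x"
      unfolding Q_def by (intro step) (use Q in \<open>auto simp: Q_def\<close>)
  qed
  then obtain u where Q: "\<And>n. Q u n (u n)"
    by blast
  have "orthonormal_on {..<n} u" for n
    using Q by (intro orthonormal_on_lessThanI) (auto simp: Q_def)
  then have "orthonormal u"
    unfolding orthonormal_on_def by (metis UNIV_I lessThan_iff lessI less_Suc_eq not_less_eq linorder_less_linear)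
  then show ?thesis
    using Q by (auto simp: Q_def)
qed

text \<open>Let \<open>d\<close> be a dense sequence. The vector \<open>e n\<close> is the normalised residual of \<open>d n\<close>, so that \<open>d n\<close> lies
  in the span of \<open>e 0, \<dots>, e n\<close>. If \<open>d n\<close> is already in the span of the earlier vectors, the residual
  of any vector outside this span is used instead; there is one because the space has infinite
  dimension.\<close>

lemma orthonormal_basis_exists:
  assumes inf: "\<nexists>B :: 'a::complex_hilbert set. finite B \<and> cspan B = UNIV"
    and sep: "separable_space (euclidean :: 'a::complex_hilbert topology)"
  obtains e :: "nat \<Rightarrow> 'a::complex_hilbert" where "orthonormal_basis e"
proof -
  obtain D :: "'a set" where D: "countable D" "closure D = UNIV"
    using sep by (auto simp: separable_space_def)
  then have "D \<noteq> {}"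
    by auto
  then obtain d :: "nat \<Rightarrow> 'a" where d: "range d = D"
    using range_from_nat_into[OF _ D(1)] that by metis
  have "\<exists>e. orthonormal e \<and> (\<forall>n. d n \<in> cspan (insert (e n) (e ` {..<n})))"
  proof (rule orthonormal_sequence_choice[where P = "\<lambda>u n x. d n \<in> cspan (insert x (u ` {..<n}))"])
    fix n and u :: "nat \<Rightarrow> 'a" assume u: "orthonormal_on {..<n} u"
    have "\<exists>y. y \<notin> cspan (u ` {..<n})"
      using inf by blast
    then obtain y where y: "y \<notin> cspan (u ` {..<n})" "d n \<notin> cspan (u ` {..<n}) \<Longrightarrow> y = d n"
      by (cases "d n \<in> cspan (u ` {..<n})") auto
    obtain x where x: "norm x = 1" "\<And>k. k < n \<Longrightarrow> cinner (u k) x = 0" "y \<in> cspan (insert x (u ` {..<n}))"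
      using Gram_Schmidt_step[OF u y(1)] by blast
    moreover have "d n \<in> cspan (insert x (u ` {..<n}))"
      using x(3) y(2) complex_vector.span_mono[of "u ` {..<n}" "insert x (u ` {..<n})"] by auto
    ultimately show "\<exists>x. norm x = 1 \<and> (\<forall>k<n. cinner (u k) x = 0) \<and> d n \<in> cspan (insert x (u ` {..<n}))"
      by blast
  next
    fix n and u v :: "nat \<Rightarrow> 'a" and x assume "\<And>k. k < n \<Longrightarrow> u k = v k"
    then have "u ` {..<n} = v ` {..<n}"
      by auto
    then show "(d n \<in> cspan (insert x (u ` {..<n}))) = (d n \<in> cspan (insert x (v ` {..<n})))"
      by simp
  qed
  then obtain e where e: "orthonormal e" "\<And>n. d n \<in> cspan (insert (e n) (e ` {..<n}))"
    by blast
  have "insert (e n) (e ` {..<n}) \<subseteq> range e" for n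
    by auto
  then have "D \<subseteq> cspan (range e)"
    using e(2) complex_vector.span_mono unfolding d[symmetric] by blast
  then have "closure (cspan (range e)) = UNIV"
    using closure_mono D(2) by (metis top.extremum_uniqueI)
  then have "orthonormal_basis e"
    using e(1) by (simp add: orthonormal_basis_def orthonormal_on_def)
  then show thesis
    by (rule that)
qed

lemma orthonormal_basis_orthonormal: "orthonormal_basis e \<Longrightarrow> orthonormal e"
  by (simp add: orthonormal_basis_def orthonormal_on_def)

lemma orthonormal_basis_orthogonal:
  assumes "orthonormal_basis e" "\<And>n. cinner (e n) x = 0"
  shows "x = 0"
proof -
  have "closed {y. cinner y x = 0}"
    by (intro closed_Collect_eq linear_continuous_on cinner.bounded_linear_left) auto
  moreover have "cspan (range e) \<subseteq> {y. cinner y x = 0}"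
    using assms(2) by (intro complex_vector.span_minimal)
      (auto simp: complex_vector.subspace_def cinner_add_left cinner_scaleC_left cinner.zero_left)
  ultimately have "closure (cspan (range e)) \<subseteq> {y. cinner y x = 0}"
    by (intro closure_minimal)
  then have "cinner x x = 0"
    using assms(1) by (auto simp: orthonormal_basis_def)
  then show ?thesis
    by (simp add: cinner_self)
qed

lemma orthonormal_basis_expansion:
  assumes "orthonormal_basis e"
  shows "(\<lambda>n. cinner (e n) x *\<^sub>C e n) sums x"
proof -
  have e: "orthonormal e"
    using assms by (rule orthonormal_basis_orthonormal)
  have "x - schmidt (\<lambda>_. 1) e e x = 0"
    by (rule orthonormal_basis_orthogonal[OF assms]) (rule schmidt_projection_residual[OF e])
  then show ?thesis
    using schmidt_sums[OF e e, of "\<lambda>_. 1" x] by simp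
qed

text \<open>The image \<open>S y\<close> must have the coefficients \<open>a i = cinner (T (e i)) y\<close>. They are square summable: for
  a partial sum \<open>t\<close> of \<open>\<Sum>i. a i e i\<close> one has \<open>(norm t)\<^sup>2 = cinner (T t) y \<le> K norm t norm y\<close>, hence
  \<open>norm t \<le> K norm y\<close>.\<close>

lemma adjoint_exists:
  fixes T :: "'a::complex_hilbert \<Rightarrow> 'a"
  assumes e: "orthonormal_basis (e :: nat \<Rightarrow> 'a)" and T: "bounded_clinear T"
  obtains S where "\<And>x y. cinner (T x) y = cinner x (S y)"
proof -
  have oe: "orthonormal e"
    using e by (rule orthonormal_basis_orthonormal)
  have BT: "bounded_linear T"
    using T by (rule bounded_clinearD)
  obtain K where K: "0 \<le> K" "\<And>x. norm (T x) \<le> K * norm x"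
    using bounded_linear.nonneg_bounded[OF BT] by (metis mult.commute)
  have "\<exists>z. \<forall>x. cinner (T x) y = cinner x z" for y
  proof -
    define a where "a i = cinner (T (e i)) y" for i
    have "summable (\<lambda>i. (cmod (a i))\<^sup>2)"
    proof (rule bounded_imp_summable[where B = "(K * norm y)\<^sup>2"])
      fix n
      define t where "t = (\<Sum>i\<le>n. a i *\<^sub>C e i)"
      have norm_t: "(norm t)\<^sup>2 = (\<Sum>i\<le>n. (cmod (a i))\<^sup>2)"
        unfolding t_def by (intro norm_orthonormal_sum) (auto intro: orthonormal_on_subset[OF oe])
      have "cinner (T t) y = (\<Sum>i\<le>n. cnj (a i) * a i)"
        unfolding t_def a_def
        by (simp add: linear_sum[OF bounded_linear.linear[OF BT]] bounded_clinearD(2)[OF T] cinner.sum_left cinner_scaleC_left)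
      also have "\<dots> = complex_of_real ((norm t)\<^sup>2)"
        unfolding norm_t by (simp only: complex_norm_square mult.commute of_real_sum)
      finally have "(norm t)\<^sup>2 = cmod (cinner (T t) y)"
        by (metis norm_of_real abs_of_nonneg zero_le_power2)
      also have "\<dots> \<le> norm (T t) * norm y"
        by (rule cinner_Cauchy_Schwarz)
      also have "\<dots> \<le> (K * norm t) * norm y"
        by (intro mult_right_mono K) auto
      finally have "norm t \<le> K * norm y"
        by (cases "norm t = 0") (auto simp: power2_eq_square K mult.commute mult.left_commute)
      then show "(\<Sum>i\<le>n. (cmod (a i))\<^sup>2) \<le> (K * norm y)\<^sup>2"
        unfolding norm_t[symmetric] by (intro power_mono) auto
    qed auto
    then have sm: "summable (\<lambda>i. a i *\<^sub>C e i)"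
      by (rule Riesz_Fischer[OF oe])
    define z where "z = (\<Sum>i. a i *\<^sub>C e i)"
    have z: "cinner (e i) z = cinner (T (e i)) y" for i
      unfolding z_def cinner_suminf_orthonormal[OF sm oe] by (simp add: a_def)
    have "cinner (T x) y = cinner x z" for x
    proof (rule sums_unique2)
      show "(\<lambda>i. cinner (cinner (e i) x *\<^sub>C e i) z) sums cinner x z"
        by (intro bounded_linear.sums[OF cinner.bounded_linear_left] orthonormal_basis_expansion e)
      have "(\<lambda>i. cinner (T (cinner (e i) x *\<^sub>C e i)) y) sums cinner (T x) y"
        by (intro bounded_linear.sums[OF cinner.bounded_linear_left] bounded_linear.sums[OF BT]
            orthonormal_basis_expansion e)
      then show "(\<lambda>i. cinner (cinner (e i) x *\<^sub>C e i) z) sums cinner (T x) y"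
        by (simp add: bounded_clinearD(2)[OF T] cinner_scaleC_left z)
    qed
    then show ?thesis
      by blast
  qed
  then show thesis
    using that by metis
qed

text \<open>The adjoint is a definite description, so that the equation \<open>cadjoint T = T\<close> carries information only
  once an adjoint is known to exist.\<close>

lemma cadjoint_symmetric:
  fixes T :: "'a::complex_hilbert \<Rightarrow> 'a"
  assumes "orthonormal_basis (e :: nat \<Rightarrow> 'a)" "bounded_clinear T" "cadjoint T = T"
  shows "cinner (T x) y = cinner x (T y)"
proof -
  obtain S where "\<And>x y. cinner (T x) y = cinner x (S y)"
    using adjoint_exists assms(1,2) by metis
  moreover from this have "cadjoint T = S"
    by (rule cadjoint_eqI)
  ultimately show ?thesis
    using assms(3) by simp
qed

section \<open>The spectral theorem for compact symmetric operators\<close>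

lemma compact_op_convergent_subsequence:
  assumes "compact_op T" "\<And>n. norm (X n) \<le> 1"
  obtains z r where "strict_mono (r :: nat \<Rightarrow> nat)" "(\<lambda>n. T (X (r n))) \<longlonglongrightarrow> z"
proof -
  have "seq_compact (closure (T ` cball 0 1))"
    using assms(1) by (intro compact_imp_seq_compact) (simp add: compact_op_def)
  moreover have "\<forall>n. T (X n) \<in> closure (T ` cball 0 1)"
    using assms(2) by (intro allI subsetD[OF closure_subset] imageI) simp
  ultimately obtain z r where "strict_mono (r :: nat \<Rightarrow> nat)" "((\<lambda>n. T (X n)) \<circ> r) \<longlonglongrightarrow> z"
    by (rule seq_compactE)
  then show thesis
    using that by (simp add: comp_def)
qed

text \<open>Take unit vectors \<open>x\<^sub>n\<close> of \<open>W\<close> with \<open>norm (T x\<^sub>n) \<longlonglongrightarrow> M\<close>, the norm of \<open>T\<close> on \<open>W\<close>. Then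
  \<open>norm (T (T x\<^sub>n) - M\<^sup>2 x\<^sub>n)\<^sup>2 \<le> M\<^sup>4 - M\<^sup>2 norm (T x\<^sub>n)\<^sup>2\<close> tends to zero, while \<open>T x\<^sub>n\<close> converges along
  a subsequence by compactness, hence so does \<open>x\<^sub>n\<close>, and its limit \<open>x\<close> satisfies \<open>T (T x) = M\<^sup>2 x\<close>.
  As \<open>T\<^sup>2 - M\<^sup>2 = (T - M) (T + M)\<close>, either \<open>x\<close> or \<open>T x + M x\<close> is an eigenvector for \<open>\<plusminus> M\<close>.\<close>

lemma compact_symmetric_extremal_eigenvector:
  fixes T :: "'a::complex_hilbert \<Rightarrow> 'a"
  assumes T: "compact_op T" and sym: "\<And>x y. cinner (T x) y = cinner x (T y)"
    and W: "complex_vector.subspace W" "closed W" and inv: "\<And>x. x \<in> W \<Longrightarrow> T x \<in> W"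
    and x0: "x0 \<in> W" "norm x0 = 1"
  obtains x t where "x \<in> W" "norm x = 1" "T x = complex_of_real t *\<^sub>C x"
    "\<And>y. y \<in> W \<Longrightarrow> norm (T y) \<le> \<bar>t\<bar> * norm y"
proof -
  have TC: "bounded_clinear T"
    using T by (auto simp: compact_op_def)
  have BT: "bounded_linear T"
    using TC by (rule bounded_clinearD)
  obtain K where K: "0 \<le> K" "\<And>x. norm (T x) \<le> K * norm x"
    using bounded_linear.nonneg_bounded[OF BT] by (metis mult.commute)
  define U where "U = {x \<in> W. norm x = 1}"
  define M where "M = (SUP x\<in>U. norm (T x))"
  have x0U: "x0 \<in> U"
    using x0 by (simp add: U_def)
  have bdd: "bdd_above ((\<lambda>x. norm (T x)) ` U)"
  proof (rule bdd_aboveI2)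
    show "norm (T x) \<le> K" if "x \<in> U" for x
      using K(2)[of x] that by (simp add: U_def)
  qed
  have MU: "norm (T x) \<le> M" if "x \<in> U" for x
    unfolding M_def by (rule cSUP_upper[OF that bdd])
  have M0: "0 \<le> M"
    using MU[OF x0U] norm_ge_zero order_trans by blast
  have scale: "r *\<^sub>C y \<in> W" if "y \<in> W" for y r
    using that W(1) by (simp add: complex_vector.subspace_scale)
  have MW: "norm (T y) \<le> M * norm y" if "y \<in> W" for y
  proof (cases "y = 0")
    case True
    then show ?thesis
      by (simp add: bounded_clinear_zero[OF TC])
  next
    case False
    have "complex_of_real (1 / norm y) *\<^sub>C y \<in> U"
      using False scale[OF that] by (simp add: U_def norm_scaleC norm_divide)
    from MU[OF this] show ?thesis
      using False by (simp add: bounded_clinearD(2)[OF TC] norm_scaleC norm_divide field_simps)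
  qed
  show thesis
  proof (cases "M = 0")
    case True
    then show thesis
      using that[of x0 0] MW x0 by (metis abs_zero complex_vector.scale_zero_left norm_le_zero_iff
          of_real_0 mult_zero_left)
  next
    case False
    then have Mpos: "0 < M"
      using M0 by simp
    have "\<exists>x\<in>U. M - inverse (real (Suc n)) < norm (T x)" for n
      using x0U bdd unfolding M_def by (intro less_cSUP_iff[THEN iffD1]) auto
    then obtain X where X: "\<And>n. X n \<in> U" "\<And>n. M - inverse (real (Suc n)) < norm (T (X n))"
      by metis
    have "(\<lambda>n. norm (T (X n))) \<longlonglongrightarrow> M"
    proof (rule tendsto_sandwich)
      show "(\<lambda>n. M - inverse (real (Suc n))) \<longlonglongrightarrow> M"
        using tendsto_diff[OF tendsto_const LIMSEQ_inverse_real_of_nat] by simp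
      show "\<forall>\<^sub>F n in sequentially. M - inverse (real (Suc n)) \<le> norm (T (X n))"
        by (intro always_eventually allI less_imp_le X(2))
      show "\<forall>\<^sub>F n in sequentially. norm (T (X n)) \<le> M"
        by (intro always_eventually allI MU X(1))
    qed auto
    then have lim: "(\<lambda>n. norm (T (X (r n)))) \<longlonglongrightarrow> M" if "strict_mono r" for r :: "nat \<Rightarrow> nat"
      using LIMSEQ_subseq_LIMSEQ[OF _ that] by (simp add: comp_def)
    have "norm (X n) \<le> 1" for n
      using X(1)[of n] by (simp add: U_def)
    then obtain z r where r: "strict_mono r" and z: "(\<lambda>n. T (X (r n))) \<longlonglongrightarrow> z"
      by (rule compact_op_convergent_subsequence[OF T])
    have "(\<lambda>n. T (T (X (r n))) - complex_of_real (M\<^sup>2) *\<^sub>C X (r n)) \<longlonglongrightarrow> 0"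
    proof (rule Lim_null_comparison)
      show "\<forall>\<^sub>F n in sequentially. norm (T (T (X (r n))) - complex_of_real (M\<^sup>2) *\<^sub>C X (r n))
               \<le> sqrt (M^4 - M\<^sup>2 * (norm (T (X (r n))))\<^sup>2)"
      proof (intro always_eventually allI)
        fix n
        let ?x = "X (r n)"
        have x: "?x \<in> W" "norm ?x = 1"
          using X(1)[of "r n"] by (auto simp: U_def)
        have "cinner (T (T ?x)) ?x = complex_of_real ((norm (T ?x))\<^sup>2)"
          by (simp only: sym cinner_self)
        then have "(norm (T (T ?x) - complex_of_real (M\<^sup>2) *\<^sub>C ?x))\<^sup>2
            = (norm (T (T ?x)))\<^sup>2 - 2 * (M\<^sup>2 * (norm (T ?x))\<^sup>2) + M^4"
          unfolding norm_diff_squared cinner_scaleC_right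
          using x(2) by (simp add: norm_scaleC norm_mult norm_power flip: of_real_power of_real_mult)
        also have "(norm (T (T ?x)))\<^sup>2 \<le> (M * norm (T ?x))\<^sup>2"
          by (intro power_mono MW inv x) auto
        finally have "(norm (T (T ?x) - complex_of_real (M\<^sup>2) *\<^sub>C ?x))\<^sup>2 \<le> M^4 - M\<^sup>2 * (norm (T ?x))\<^sup>2"
          by (simp add: power_mult_distrib)
        then show "norm (T (T ?x) - complex_of_real (M\<^sup>2) *\<^sub>C ?x) \<le> sqrt (M^4 - M\<^sup>2 * (norm (T ?x))\<^sup>2)"
          by (rule real_le_rsqrt)
      qed
      have "(\<lambda>n. sqrt (M^4 - M\<^sup>2 * (norm (T (X (r n))))\<^sup>2)) \<longlonglongrightarrow> sqrt (M^4 - M\<^sup>2 * M\<^sup>2)"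
        by (intro tendsto_intros lim r)
      then show "(\<lambda>n. sqrt (M^4 - M\<^sup>2 * (norm (T (X (r n))))\<^sup>2)) \<longlonglongrightarrow> 0"
        by (simp add: power2_eq_square power4_eq_xxxx)
    qed
    then have "(\<lambda>n. T (T (X (r n))) - (T (T (X (r n))) - complex_of_real (M\<^sup>2) *\<^sub>C X (r n))) \<longlonglongrightarrow> T z - 0"
      by (intro tendsto_diff bounded_linear.tendsto[OF BT] z)
    then have *: "(\<lambda>n. complex_of_real (1 / M\<^sup>2) *\<^sub>C (complex_of_real (M\<^sup>2) *\<^sub>C X (r n)))
                 \<longlonglongrightarrow> complex_of_real (1 / M\<^sup>2) *\<^sub>C T z"
      by (intro scaleC.tendsto tendsto_const) simp
    define x where "x = complex_of_real (1 / M\<^sup>2) *\<^sub>C T z"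
    have limX: "(\<lambda>n. X (r n)) \<longlonglongrightarrow> x"
      using * Mpos by (simp add: x_def scaleC_scaleC scaleC_one)
    have xW: "x \<in> W"
      using closed_sequentially[OF W(2) _ limX] X(1) by (auto simp: U_def)
    have "(\<lambda>n. norm (X (r n))) \<longlonglongrightarrow> norm x"
      by (intro tendsto_norm limX)
    then have xn: "norm x = 1"
      using X(1) by (simp add: U_def LIMSEQ_const_iff)
    have "T x = z"
      using LIMSEQ_unique[OF z bounded_linear.tendsto[OF BT limX]] by simp
    then have TTx: "T (T x) = complex_of_real (M\<^sup>2) *\<^sub>C x"
      using Mpos by (simp add: x_def scaleC_scaleC scaleC_one)
    define y where "y = T x + complex_of_real M *\<^sub>C x"
    have yW: "y \<in> W"
      unfolding y_def using W(1) xW inv by (simp add: complex_vector.subspace_add complex_vector.subspace_scale)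
    show thesis
    proof (cases "y = 0")
      case True
      then have "T x = - (complex_of_real M *\<^sub>C x)"
        unfolding y_def eq_neg_iff_add_eq_0 .
      then have "T x = complex_of_real (- M) *\<^sub>C x"
        by (simp add: complex_vector.scale_minus_left)
      then show thesis
        using xW xn MW M0 by (intro that[of x "- M"]) auto
    next
      case False
      have "T y = complex_of_real M *\<^sub>C y"
        unfolding y_def bounded_clinear_add[OF TC] bounded_clinearD(2)[OF TC] TTx scaleC_add_right scaleC_scaleC
        by (simp add: power2_eq_square add.commute)
      then have "T (complex_of_real (1 / norm y) *\<^sub>C y) = complex_of_real M *\<^sub>C complex_of_real (1 / norm y) *\<^sub>C y"
        unfolding bounded_clinearD(2)[OF TC] by (simp add: scaleC_scaleC mult.commute)
      then show thesis
        using scale[OF yW] MW M0 False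
        by (intro that[of "complex_of_real (1 / norm y) *\<^sub>C y" M]) (auto simp: norm_scaleC norm_divide)
    qed
  qed
qed

text \<open>Extremal eigenvectors are chosen repeatedly, each in the orthogonal complement \<open>W\<close> of the earlier
  ones, which \<open>T\<close> leaves invariant. Extremality gives \<open>norm (T y) \<le> \<bar>c n\<bar> norm y\<close> on the \<open>n\<close>-th
  complement, so the moduli decrease. They tend to zero, because otherwise the vectors \<open>T (u n)\<close> would
  keep a positive distance from each other, against compactness. Consequently \<open>T\<close> vanishes on every
  vector orthogonal to all \<open>u n\<close>.\<close>

theorem compact_symmetric_spectral_theorem:
  fixes T :: "'a::complex_hilbert \<Rightarrow> 'a"
  assumes inf: "\<nexists>B :: 'a set. finite B \<and> cspan B = UNIV"
    and T: "compact_op T" and sym: "\<And>x y. cinner (T x) y = cinner x (T y)"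
  obtains u c where "orthonormal u" "T = schmidt c u u" "antimono (\<lambda>n. \<bar>c n\<bar>)" "c \<longlonglongrightarrow> 0"
proof -
  have TC: "bounded_clinear T"
    using T by (auto simp: compact_op_def)
  define P where "P u n x \<longleftrightarrow> (\<exists>t. T x = complex_of_real t *\<^sub>C x \<and>
      (\<forall>y. (\<forall>k<n. cinner (u k) y = 0) \<longrightarrow> norm (T y) \<le> \<bar>t\<bar> * norm y))"
    for u :: "nat \<Rightarrow> 'a" and n x
  have "\<exists>u. orthonormal u \<and> (\<forall>n. P u n (u n))"
  proof (rule orthonormal_sequence_choice[where P = P])
    fix n and u :: "nat \<Rightarrow> 'a"
    assume u: "orthonormal_on {..<n} u" and eig: "\<And>k. k < n \<Longrightarrow> P u k (u k)"
    define W where "W = {y. \<forall>k<n. cinner (u k) y = 0}"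
    have "complex_vector.subspace W"
      by (auto simp: W_def complex_vector.subspace_def cinner_add_right cinner_scaleC_right cinner.zero_right)
    moreover have "closed W"
      unfolding W_def by (intro closed_Collect_all closed_Collect_imp closed_Collect_eq
          linear_continuous_on cinner.bounded_linear_right) auto
    moreover have "T y \<in> W" if "y \<in> W" for y
      unfolding W_def
    proof (intro CollectI allI impI)
      fix k assume "k < n"
      then obtain t where "T (u k) = complex_of_real t *\<^sub>C u k"
        using eig by (auto simp: P_def)
      then show "cinner (u k) (T y) = 0"
        using that \<open>k < n\<close> by (simp add: W_def cinner_scaleC_left flip: sym)
    qed
    moreover obtain x0 where "norm x0 = 1" "x0 \<in> W"
    proof -
      obtain y where "y \<notin> cspan (u ` {..<n})"
        using inf by blast
      then show thesis
        using Gram_Schmidt_step[OF u] that by (auto simp: W_def)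
    qed
    ultimately obtain x t where "x \<in> W" "norm x = 1" "T x = complex_of_real t *\<^sub>C x"
      "\<And>y. y \<in> W \<Longrightarrow> norm (T y) \<le> \<bar>t\<bar> * norm y"
      using compact_symmetric_extremal_eigenvector[OF T sym, of W x0] by blast
    then show "\<exists>x. norm x = 1 \<and> (\<forall>k<n. cinner (u k) x = 0) \<and> P u n x"
      unfolding P_def W_def by blast
  qed (simp add: P_def)
  then obtain u where u: "orthonormal u" and "\<And>n. P u n (u n)"
    by blast
  then obtain c where c: "\<And>n. T (u n) = complex_of_real (c n) *\<^sub>C u n"
    and max: "\<And>n y. (\<And>k. k < n \<Longrightarrow> cinner (u k) y = 0) \<Longrightarrow> norm (T y) \<le> \<bar>c n\<bar> * norm y"
    unfolding P_def by metis
  have nu: "norm (u n) = 1" for n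
    using orthonormal_on_norm[OF u] by simp
  have anti: "antimono (\<lambda>n. \<bar>c n\<bar>)"
  proof (rule antimonoI)
    fix m n :: nat assume "m \<le> n"
    then have "norm (T (u n)) \<le> \<bar>c m\<bar> * norm (u n)"
      by (intro max) (simp add: orthonormal_cinner[OF u])
    then show "\<bar>c n\<bar> \<le> \<bar>c m\<bar>"
      by (simp add: c nu norm_scaleC)
  qed
  have c0: "c \<longlonglongrightarrow> 0"
  proof (rule ccontr)
    assume not: "\<not> c \<longlonglongrightarrow> 0"
    obtain d where d: "0 < d" "\<And>n. d \<le> \<bar>c n\<bar>"
    proof (rule ccontr)
      assume "\<not> thesis"
      then have "\<And>d. 0 < d \<Longrightarrow> \<exists>N. \<bar>c N\<bar> < d"
        using that by (meson not_le)
      then have "\<exists>N. \<forall>n\<ge>N. norm (c n - 0) < e" if "0 < e" for e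
        using that antimonoD[OF anti] by (metis diff_zero le_less_trans real_norm_def)
      then have "c \<longlonglongrightarrow> 0"
        by (rule LIMSEQ_I)
      with not show False ..
    qed
    obtain z r where r: "strict_mono r" and z: "(\<lambda>n. T (u (r n))) \<longlonglongrightarrow> z"
      by (rule compact_op_convergent_subsequence[OF T, of u]) (simp_all add: nu)
    then have "Cauchy (\<lambda>n. T (u (r n)))"
      by (intro LIMSEQ_imp_Cauchy)
    then obtain N where N: "\<And>m n. m \<ge> N \<Longrightarrow> n \<ge> N \<Longrightarrow> norm (T (u (r m)) - T (u (r n))) < d"
      using CauchyD d(1) by metis
    let ?m = "r N" and ?n = "r (Suc N)"
    have "?m \<noteq> ?n"
      using r by (simp add: strict_mono_eq)
    then have "(norm (T (u ?m) - T (u ?n)))\<^sup>2 = (c ?m)\<^sup>2 + (c ?n)\<^sup>2"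
      unfolding norm_diff_squared c
      by (simp add: norm_scaleC nu cinner_scaleC_left cinner_scaleC_right orthonormal_cinner[OF u])
    moreover have "d\<^sup>2 \<le> (c ?m)\<^sup>2"
      using d(1) d(2)[of ?m] abs_le_square_iff[of d "c ?m"] by simp
    moreover have "(norm (T (u ?m) - T (u ?n)))\<^sup>2 < d\<^sup>2"
      using N[of N "Suc N"] by (intro power_strict_mono) auto
    ultimately show False
      by (smt (verit) zero_le_power2)
  qed
  have Bc: "Bseq c"
    by (rule convergent_imp_Bseq[OF convergentI[OF c0]])
  have "T = schmidt c u u"
  proof (rule schmidt_eqI[OF u u Bc TC c])
    fix x assume "\<And>n. cinner (u n) x = 0"
    then have "norm (T x) \<le> \<bar>c n\<bar> * norm x" for n
      by (intro max) auto
    moreover have "(\<lambda>n. \<bar>c n\<bar> * norm x) \<longlonglongrightarrow> \<bar>0\<bar> * norm x"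
      by (intro tendsto_intros c0)
    ultimately have "norm (T x) \<le> \<bar>0\<bar> * norm x"
      by (intro LIMSEQ_le_const) auto
    then show "T x = 0"
      by simp
  qed
  then show thesis
    using that u anti c0 by blast
qed

section \<open>Eigenvalue sequences and membership in the ideal\<close>

text \<open>At the first index where two candidates differ, the larger value would occur more often in one
  of them than in the other.\<close>

lemma level_sets_determine_antimono_sequence:
  fixes l m :: "nat \<Rightarrow> real"
  assumes l: "antimono l" "\<And>j. 0 \<le> l j" and m: "antimono m" "\<And>j. 0 \<le> m j"
    and levels: "\<And>t. 0 < t \<Longrightarrow> finite {j. l j = t} \<and> finite {j. m j = t} \<and> card {j. l j = t} = card {j. m j = t}"
  shows "l = m"
proof -
  have False
    if l: "antimono l" "\<And>j. 0 \<le> l j"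
      and levels: "\<And>t. 0 < t \<Longrightarrow> finite {j. m j = t} \<and> card {j. l j = t} = card {j. m j = t}"
      and less: "l j < m j" and first: "\<And>i. i < j \<Longrightarrow> l i = m i" for l m :: "nat \<Rightarrow> real" and j
  proof -
    have "l i < m j" if "j \<le> i" for i
      using antimonoD[OF l(1) that] less by linarith
    then have "i < j" if "l i = m j" for i
      using that by (metis less_irrefl not_le)
    then have "{i. l i = m j} \<subseteq> {i. m i = m j}"
      using first by (metis (mono_tags, lifting) mem_Collect_eq subsetI)
    moreover have "j \<notin> {i. l i = m j}" "j \<in> {i. m i = m j}"
      using less by auto
    ultimately have "{i. l i = m j} \<subset> {i. m i = m j}"
      by blast
    then have "card {i. l i = m j} < card {i. m i = m j}"
      using levels[of "m j"] l(2)[of j] less by (intro psubset_card_mono) auto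
    then show False
      using levels[of "m j"] l(2)[of j] less by auto
  qed
  note first_difference = this
  show ?thesis
  proof (rule ccontr)
    assume "l \<noteq> m"
    then obtain i where "l i \<noteq> m i"
      by auto
    define j where "j = (LEAST j. l j \<noteq> m j)"
    have j: "l j \<noteq> m j" "\<And>i. i < j \<Longrightarrow> l i = m i"
      unfolding j_def using \<open>l i \<noteq> m i\<close> by (rule LeastI, use not_less_Least in blast)
    then show False
      using first_difference[of l m j] first_difference[of m l j] l m levels by (metis linorder_neqE)
  qed
qed

lemma eigenvalues_eqI:
  assumes "antimono l" "\<And>j. 0 \<le> l j"
    and "\<And>t. 0 < t \<Longrightarrow> finite {j. l j = t} \<and> card {j. l j = t} = cdim {x. P x = complex_of_real t *\<^sub>C x}"
  shows "eigenvalues P = l"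
  unfolding eigenvalues_def
proof (rule the_equality)
  fix m :: "nat \<Rightarrow> real" assume "antimono m \<and> (\<forall>j. 0 \<le> m j) \<and>
     (\<forall>t>0. finite {j. m j = t} \<and> card {j. m j = t} = cdim {x. P x = complex_of_real t *\<^sub>C x})"
  then show "m = l"
    using assms by (intro level_sets_determine_antimono_sequence) auto
qed (use assms in auto)

lemma orthonormal_inj: "orthonormal u \<Longrightarrow> inj u"
  unfolding orthonormal_on_def inj_def by (metis UNIV_I zero_neq_one)

lemma orthonormal_independent:
  assumes "orthonormal u" "finite A"
  shows "complex_vector.independent (u ` A)"
proof (rule complex_vector.independent_if_scalars_zero)
  fix f x assume 0: "(\<Sum>x\<in>u ` A. f x *\<^sub>C x) = 0" and "x \<in> u ` A"
  then obtain k where k: "k \<in> A" "x = u k"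
    by blast
  have "(\<Sum>i\<in>A. f (u i) *\<^sub>C u i) = 0"
    using 0 orthonormal_inj[OF assms(1)] by (subst (asm) sum.reindex) (auto intro: inj_on_subset)
  then have "cinner (u k) (\<Sum>i\<in>A. f (u i) *\<^sub>C u i) = 0"
    by (simp add: cinner.zero_right)
  then show "f x = 0"
    using cinner_orthonormal_sum[OF orthonormal_on_subset[OF assms(1)] assms(2) k(1), of "\<lambda>i. f (u i)"] k(2)
    by simp
qed (use assms in simp)

lemma schmidt_eigenspace:
  assumes u: "orthonormal u" and c: "c \<longlonglongrightarrow> 0" and t: "0 < t"
  shows "finite {n. c n = t}"
    and "card {n. c n = t} = cdim {x. schmidt c u u x = complex_of_real t *\<^sub>C x}"
proof -
  let ?A = "{n. c n = t}"
  have Bc: "Bseq c"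
    by (rule convergent_imp_Bseq[OF convergentI[OF c]])
  obtain N where "\<And>n. n \<ge> N \<Longrightarrow> \<bar>c n\<bar> < t"
    using c t unfolding lim_sequentially dist_real_def by (metis diff_zero)
  then have "?A \<subseteq> {..<N}"
    by (force simp: not_le[symmetric])
  then show fin: "finite ?A"
    by (rule finite_subset) simp
  have "{x. schmidt c u u x = complex_of_real t *\<^sub>C x} = cspan (u ` ?A)"
  proof (intro equalityI subsetI)
    fix x assume "x \<in> {x. schmidt c u u x = complex_of_real t *\<^sub>C x}"
    then have x: "schmidt c u u x = complex_of_real t *\<^sub>C x"
      by simp
    have "cinner (u n) x = 0" if "c n \<noteq> t" for n
      using cinner_schmidt[OF u u Bc, of n x] that by (simp add: x cinner_scaleC_right)
    then have "schmidt c u u x = (\<Sum>n\<in>?A. (complex_of_real (c n) * cinner (u n) x) *\<^sub>C u n)"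
      unfolding schmidt_def by (intro suminf_finite fin) auto
    then have "complex_of_real t *\<^sub>C x \<in> cspan (u ` ?A)"
      unfolding x by (simp only:) (intro complex_vector.span_sum complex_vector.span_scale complex_vector.span_base imageI)
    then have "complex_of_real (1 / t) *\<^sub>C complex_of_real t *\<^sub>C x \<in> cspan (u ` ?A)"
      by (rule complex_vector.span_scale)
    then show "x \<in> cspan (u ` ?A)"
      using t by (simp add: scaleC_scaleC scaleC_one)
  next
    have lin: "bounded_clinear (schmidt c u u)"
      by (rule bounded_clinear_schmidt[OF u u Bc])
    have "complex_vector.subspace {x. schmidt c u u x = complex_of_real t *\<^sub>C x}"
      by (auto simp: complex_vector.subspace_def bounded_clinear_zero[OF lin] bounded_clinear_add[OF lin]
          bounded_clinearD(2)[OF lin] scaleC_add_right scaleC_scaleC mult.commute)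
    moreover have "u ` ?A \<subseteq> {x. schmidt c u u x = complex_of_real t *\<^sub>C x}"
      by (auto simp: schmidt_basis[OF u])
    ultimately have "cspan (u ` ?A) \<subseteq> {x. schmidt c u u x = complex_of_real t *\<^sub>C x}"
      by (intro complex_vector.span_minimal)
    then show "x \<in> {x. schmidt c u u x = complex_of_real t *\<^sub>C x}" if "x \<in> cspan (u ` ?A)" for x
      using that by blast
  qed
  then have "cdim {x. schmidt c u u x = complex_of_real t *\<^sub>C x} = card (u ` ?A)"
    using complex_vector.dim_span_eq_card_independent[OF orthonormal_independent[OF u fin]] by simp
  also have "\<dots> = card ?A"
    by (intro card_image inj_on_subset[OF orthonormal_inj[OF u]]) simp
  finally show "card ?A = cdim {x. schmidt c u u x = complex_of_real t *\<^sub>C x}" ..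
qed

theorem positive_compact_spectral_theorem:
  fixes P :: "'a::complex_hilbert \<Rightarrow> 'a"
  assumes inf: "\<nexists>B :: 'a set. finite B \<and> cspan B = UNIV"
    and P: "positive_op P" "compact_op P"
  obtains u where "orthonormal u" "P = schmidt (eigenvalues P) u u"
    "antimono (eigenvalues P)" "\<And>j. 0 \<le> eigenvalues P j" "eigenvalues P \<longlonglongrightarrow> 0"
proof -
  obtain u c where u: "orthonormal u" and Pc: "P = schmidt c u u"
    and anti: "antimono (\<lambda>n. \<bar>c n\<bar>)" and c: "c \<longlonglongrightarrow> 0"
    using compact_symmetric_spectral_theorem[OF inf P(2) positive_op_symmetric[OF P(1)]] by blast
  have nn: "0 \<le> c n" for n
  proof -
    have "cinner (u n) (P (u n)) = complex_of_real (c n)"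
      by (simp add: Pc schmidt_basis[OF u] cinner_scaleC_right orthonormal_cinner[OF u])
    then show ?thesis
      using P(1) by (metis positive_op_def complex_nonneg_Reals_iff Re_complex_of_real)
  qed
  then have "antimono c"
    using anti by simp
  moreover have "eigenvalues P = c"
    unfolding Pc using schmidt_eigenspace[OF u c] nn \<open>antimono c\<close> by (intro eigenvalues_eqI) auto
  ultimately show thesis
    using that[of u] u Pc nn c by simp
qed

text \<open>The values \<open>l 0, \<dots>, l j\<close> are taken by \<open>l\<close> at \<open>j + 1\<close> or more indices, hence also by \<open>c\<close>; the indices
  below \<open>j\<close> are too few for that.\<close>

lemma rearrangement_bound:
  fixes l c :: "nat \<Rightarrow> real"
  assumes l: "antimono l" "0 < l j"
    and levels: "\<And>t. 0 < t \<Longrightarrow> finite {j. l j = t} \<and> finite {n. c n = t} \<and> card {j. l j = t} = card {n. c n = t}"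
  obtains i where "j \<le> i" "l j \<le> c i"
proof -
  define S where "S = l ` {..j}"
  have S: "finite S" and S_ge: "\<And>t. t \<in> S \<Longrightarrow> l j \<le> t"
    using antimonoD[OF l(1)] by (auto simp: S_def)
  have S_pos: "0 < t" if "t \<in> S" for t
    using S_ge[OF that] l(2) by linarith
  have "{..j} \<subseteq> (\<Union>t\<in>S. {i. l i = t})"
    by (auto simp: S_def)
  then have "card {..j} \<le> card (\<Union>t\<in>S. {i. l i = t})"
    using S S_pos levels by (intro card_mono) auto
  also have "\<dots> = (\<Sum>t\<in>S. card {i. l i = t})"
    using S S_pos levels by (intro card_UN_disjoint) auto
  also have "\<dots> = (\<Sum>t\<in>S. card {n. c n = t})"
    using S_pos levels by (intro sum.cong) auto
  also have "\<dots> = card (\<Union>t\<in>S. {n. c n = t})"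
    using S S_pos levels by (intro card_UN_disjoint[symmetric]) auto
  finally have card: "Suc j \<le> card (\<Union>t\<in>S. {n. c n = t})"
    by simp
  have "\<not> (\<Union>t\<in>S. {n. c n = t}) \<subseteq> {..<j}"
  proof
    assume "(\<Union>t\<in>S. {n. c n = t}) \<subseteq> {..<j}"
    then have "card (\<Union>t\<in>S. {n. c n = t}) \<le> j"
      using card_mono[of "{..<j}"] by fastforce
    with card show False
      by simp
  qed
  then obtain i where "c i \<in> S" "j \<le> i"
    by (force simp: subset_eq not_less)
  then show thesis
    using that S_ge by auto
qed

lemma bigo_tendsto_0:
  fixes c f :: "nat \<Rightarrow> real"
  assumes "c \<in> O(f)" "f \<longlonglongrightarrow> 0"
  shows "c \<longlonglongrightarrow> 0"
proof -
  have "f \<in> o(\<lambda>_. 1)"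
    using assms(2) by (intro smalloI_tendsto) auto
  then show ?thesis
    using smalloD_tendsto[OF landau_o.big_small_trans[OF assms(1)]] by fastforce
qed

text \<open>The singular values form the decreasing rearrangement of \<open>\<bar>c\<bar>\<close>. By \<open>rearrangement_bound\<close> the one with
  index \<open>j\<close>, unless it is zero, is at most \<open>\<bar>c i\<bar> \<le> K g(i)\<close> for some \<open>i \<ge> j\<close>, and \<open>g\<close> decreases.\<close>

lemma schmidt_in_weak_lorentz:
  fixes u v :: "nat \<Rightarrow> 'a::complex_hilbert"
  assumes inf: "\<nexists>B :: 'a set. finite B \<and> cspan B = UNIV"
    and u: "orthonormal u" "orthonormal v"
    and g: "\<And>t. 0 \<le> t \<Longrightarrow> 0 < g t" "antimono_on {a..} g" "(g \<longlongrightarrow> 0) at_top"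
    and c: "c \<in> O(\<lambda>j. g (real j))"
  shows "schmidt c u v \<in> weak_lorentz g"
proof -
  have c0: "c \<longlonglongrightarrow> 0"
    by (rule bigo_tendsto_0[OF c filterlim_compose[OF g(3) filterlim_real_sequentially]])
  then have c0': "(\<lambda>n. \<bar>c n\<bar>) \<longlonglongrightarrow> 0"
    by (rule tendsto_rabs_zero)
  have Bc: "Bseq c" "Bseq (\<lambda>n. \<bar>c n\<bar>)"
    using c0 c0' by (auto intro!: convergent_imp_Bseq simp: convergent_def)
  let ?P = "schmidt (\<lambda>n. \<bar>c n\<bar>) u u"
  define l where "l = eigenvalues ?P"
  obtain w where w: "orthonormal w" "?P = schmidt l w w" "antimono l" "\<And>j. 0 \<le> l j" "l \<longlonglongrightarrow> 0"
    unfolding l_def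
    using positive_compact_spectral_theorem[OF inf positive_op_schmidt[OF u(1) Bc(2)] compact_op_schmidt[OF u(1) u(1) c0']]
    by (metis abs_ge_zero)
  have levels: "finite {j. l j = t} \<and> finite {n. \<bar>c n\<bar> = t} \<and> card {j. l j = t} = card {n. \<bar>c n\<bar> = t}"
    if "0 < t" for t
    using schmidt_eigenspace[OF u(1) c0' that] schmidt_eigenspace[OF w(1,5) that] w(2) by simp
  obtain K where K: "0 < K" "\<forall>\<^sub>F j in sequentially. norm (c j) \<le> K * norm (g (real j))"
    using c by (auto elim: landau_o.bigE)
  then obtain N where N: "\<And>n. n \<ge> N \<Longrightarrow> \<bar>c n\<bar> \<le> K * g (real n)"
    using g(1) unfolding eventually_sequentially by (metis abs_of_pos of_nat_0_le_iff real_norm_def)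
  have "l \<in> O(\<lambda>j. g (real j))"
  proof (rule landau_o.bigI[OF K(1)])
    show "\<forall>\<^sub>F j in sequentially. norm (l j) \<le> K * norm (g (real j))"
      using eventually_ge_at_top[of "max N (nat \<lceil>a\<rceil>)"]
    proof eventually_elim
      case (elim j)
      have "l j \<le> K * g (real j)"
      proof (cases "0 < l j")
        case True
        then obtain i where i: "j \<le> i" "l j \<le> \<bar>c i\<bar>"
          using rearrangement_bound[OF w(3) _ levels] by blast
        have "a \<le> real j"
          using elim by linarith
        then have "g (real i) \<le> g (real j)"
          using i(1) by (intro monotone_onD[OF g(2)]) auto
        then have "K * g (real i) \<le> K * g (real j)"
          using K(1) by simp
        then show ?thesis
          using i N[of i] elim by simp
      next
        case False
        then show ?thesis
          using K(1) g(1)[of "real j"] by (smt (verit) mult_pos_pos of_nat_0_le_iff)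
      qed
      then show ?case
        using w(4)[of j] g(1)[of "real j"] by simp
    qed
  qed
  then show ?thesis
    using compact_op_schmidt[OF u c0]
    by (simp add: weak_lorentz_def singular_values_def modulus_schmidt[OF u Bc(1)] l_def)
qed

lemma Bseq_plus:
  fixes f g :: "nat \<Rightarrow> 'a::real_normed_vector"
  assumes "Bseq f" "Bseq g"
  shows "Bseq (\<lambda>n. f n + g n)"
proof -
  obtain K L where "\<And>n. norm (f n) \<le> K" "\<And>n. norm (g n) \<le> L"
    using assms by (auto simp: Bseq_def)
  then show ?thesis
    by (intro BseqI'[of _ "K + L"] norm_triangle_mono)
qed

lemma pos_part_schmidt:
  assumes u: "orthonormal u" and c: "Bseq c"
  shows "pos_part (schmidt c u u) = schmidt (\<lambda>n. (1/2) * (\<bar>c n\<bar> + c n)) u u"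
proof -
  have abs: "Bseq (\<lambda>n. \<bar>c n\<bar>)"
    using c by (simp add: Bseq_def)
  show ?thesis
    unfolding pos_part_def modulus_schmidt[OF u u c] schmidt_scale[OF u u Bseq_plus[OF abs c]]
      schmidt_add[OF u u abs c] scaleR_scaleC ..
qed

lemma neg_part_schmidt:
  assumes u: "orthonormal u" and c: "Bseq c"
  shows "neg_part (schmidt c u u) = schmidt (\<lambda>n. (1/2) * (\<bar>c n\<bar> + (-1) * c n)) u u"
proof -
  have abs: "Bseq (\<lambda>n. \<bar>c n\<bar>)" and neg: "Bseq (\<lambda>n. (-1) * c n)"
    using c by (simp_all add: Bseq_def)
  show ?thesis
    unfolding neg_part_def modulus_schmidt[OF u u c] schmidt_scale[OF u u Bseq_plus[OF abs neg]]
      schmidt_add[OF u u abs neg] schmidt_scale[OF u u c] scaleR_scaleC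
    by (simp add: complex_vector.scale_minus_left scaleC_one)
qed

section \<open>Regular variation of index minus one\<close>

text \<open>If \<open>g\<close> increased, the ratio \<open>g(2t) / g(t)\<close> would stay above \<open>1\<close>, but it tends to \<open>1/2\<close>.\<close>

lemma RV_minus_one_antimono:
  assumes "RV_minus_one g"
  obtains a where "0 \<le> a" "antimono_on {a..} g"
proof -
  obtain a where a: "0 \<le> a" "mono_on {a..} g \<or> antimono_on {a..} g"
    using assms by (auto simp: RV_minus_one_def)
  have "\<not> mono_on {a..} g"
  proof
    assume mono: "mono_on {a..} g"
    have "\<forall>\<^sub>F t in at_top. 1 \<le> g (2 * t) / g t"
      using eventually_ge_at_top[of a]
    proof eventually_elim
      case (elim t)
      then have "g t \<le> g (2 * t)"
        using a(1) by (intro monotone_onD[OF mono]) auto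
      then show ?case
        using assms a(1) elim by (simp add: RV_minus_one_def)
    qed
    moreover have "((\<lambda>t. g (2 * t) / g t) \<longlongrightarrow> inverse 2) at_top"
      using assms unfolding RV_minus_one_def by (elim conjE allE[of _ 2]) simp
    ultimately have "1 \<le> inverse (2::real)"
      by (intro tendsto_lowerbound) auto
    then show False
      by simp
  qed
  then show thesis
    using a that by blast
qed

text \<open>As \<open>g(2t) / g(t)\<close> tends to \<open>1/2\<close>, it is eventually below \<open>3/4\<close>, so \<open>g\<close> decays geometrically along the
  points \<open>2\<^sup>k s\<close>; monotonicity takes care of the points in between.\<close>

lemma RV_minus_one_tendsto_0:
  assumes "RV_minus_one g"
  shows "(g \<longlongrightarrow> 0) at_top"
proof -
  have pos: "0 < g t" if "0 \<le> t" for t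
    using assms that by (simp add: RV_minus_one_def)
  obtain a where a: "0 \<le> a" "antimono_on {a..} g"
    using RV_minus_one_antimono[OF assms] by blast
  have "((\<lambda>t. g (2 * t) / g t) \<longlongrightarrow> inverse 2) at_top"
    using assms unfolding RV_minus_one_def by (elim conjE allE[of _ 2]) simp
  then have "\<forall>\<^sub>F t in at_top. g (2 * t) / g t < 3 / 4"
    by (rule order_tendstoD) simp
  then obtain t1 where t1: "\<And>t. t \<ge> t1 \<Longrightarrow> g (2 * t) / g t < 3 / 4"
    by (auto simp: eventually_at_top_linorder)
  define s where "s = max 1 (max a t1)"
  have s: "1 \<le> s" "a \<le> s" "t1 \<le> s"
    by (auto simp: s_def)
  have ge: "s \<le> 2 ^ k * s" for k :: nat
    using s(1) by simp
  have bound: "g (2 ^ k * s) \<le> (3/4) ^ k * g s" for k :: nat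
  proof (induction k)
    case (Suc k)
    have "t1 \<le> 2 ^ k * s" "0 \<le> 2 ^ k * s"
      using ge[of k] s by linarith+
    then have "g (2 * (2 ^ k * s)) < 3 / 4 * g (2 ^ k * s)"
      using t1[of "2 ^ k * s"] pos[of "2 ^ k * s"] by (simp add: pos_divide_less_eq)
    with Suc show ?case
      by (simp add: mult.assoc)
  qed simp
  show ?thesis
  proof (rule tendstoI)
    fix e :: real assume "0 < e"
    have "(\<lambda>k. (3/4) ^ k * g s) \<longlonglongrightarrow> 0 * g s"
      by (intro tendsto_intros LIMSEQ_power_zero) auto
    then have "\<forall>\<^sub>F k in sequentially. (3/4) ^ k * g s < e"
      using \<open>0 < e\<close> by (intro order_tendstoD) auto
    then obtain k where k: "(3/4) ^ k * g s < e"
      by (auto simp: eventually_sequentially)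
    show "\<forall>\<^sub>F t in at_top. dist (g t) 0 < e"
      using eventually_ge_at_top[of "2 ^ k * s"]
    proof eventually_elim
      case (elim t)
      have "a \<le> 2 ^ k * s" "0 \<le> t"
        using ge[of k] s elim by linarith+
      then have "g t \<le> g (2 ^ k * s)"
        using elim by (intro monotone_onD[OF a(2)]) auto
      then show ?case
        using bound[of k] k pos[OF \<open>0 \<le> t\<close>] by simp
    qed
  qed
qed

section \<open>Averages along the binary tree\<close>

text \<open>The nodes of a binary tree are numbered so that \<open>j div 2\<close> is the parent of \<open>j\<close>. The sequence below
  solves \<open>y j = a j + y (j div 2) / 2\<close>; the value at \<open>0\<close>, which is its own parent, makes the equation
  hold there too.\<close>

fun tree_sum :: "(nat \<Rightarrow> real) \<Rightarrow> nat \<Rightarrow> real" where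
  "tree_sum a j = (if j = 0 then 2 * a 0 else a j + tree_sum a (j div 2) / 2)"

declare tree_sum.simps [simp del]

lemma tree_sum_eq: "tree_sum a j = a j + tree_sum a (j div 2) / 2"
  by (cases "j = 0") (simp_all add: tree_sum.simps[of a 0] tree_sum.simps[of a j])

text \<open>Put \<open>F j = (j + 1) \<bar>tree_sum a j\<bar>\<close>. Since \<open>(j + 1) / 2 \<le> j div 2 + 1\<close>, passing from \<open>j div 2\<close> to \<open>j\<close>
  adds, for large \<open>j\<close>, at most \<open>(j + 1) \<bar>a j\<bar> \<le> 2 j b(j)\<close> to \<open>F\<close>, and as \<open>b\<close> decreases this is at most
  four times its integral from \<open>j / 2\<close> to \<open>j\<close>. The integrals over the intervals from \<open>j div 2\<close> to \<open>j\<close> add up along the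
  path to the root, and \<open>K\<close> accounts for the small indices.\<close>

lemma tree_sum_bound:
  fixes a :: "nat \<Rightarrow> real" and b :: "real \<Rightarrow> real"
  assumes b: "antimono_on {s..} b" "\<And>t. s \<le> t \<Longrightarrow> 0 \<le> b t" and s: "0 \<le> s"
    and a: "\<And>j. s \<le> real j \<Longrightarrow> \<bar>a j\<bar> \<le> b (real j)"
  obtains K where "\<And>j. (real j + 1) * \<bar>tree_sum a j\<bar> \<le> K + 4 * integral {s..real j} b"
proof -
  \<comment> \<open>For \<open>j \<ge> N\<close> both \<open>j / 2\<close> and the parent \<open>j div 2\<close> lie in the range where \<open>b\<close> decreases.\<close>
  define N where "N = nat \<lceil>2 * s\<rceil> + 2"
  have N: "2 * s + 2 \<le> real N"
    unfolding N_def by linarith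
  define F where "F j = (real j + 1) * \<bar>tree_sum a j\<bar>" for j
  define K where "K = (\<Sum>j<N. F j)"
  have F0: "0 \<le> F j" for j
    by (simp add: F_def)
  have int: "b integrable_on {x..y}" if "s \<le> x" for x y
  proof -
    have "mono_on {x..y} (\<lambda>t. - b t)"
      using that by (intro mono_onI) (auto intro!: monotone_onD[OF b(1)])
    then have "(\<lambda>t. - b t) integrable_on {x..y}"
      by (rule integrable_on_mono_on)
    then show ?thesis
      using integrable_neg by fastforce
  qed
  have "F j \<le> K + 4 * integral {s..real j} b" for j
  proof (induction j rule: less_induct)
    case (less j)
    show ?case
    proof (cases "j < N")
      case True
      then have "F j \<le> K"
        unfolding K_def by (intro member_le_sum) (auto simp: F0)
      moreover have "0 \<le> integral {s..real j} b"
        by (intro integral_nonneg int) (auto simp: b)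
      ultimately show ?thesis
        by simp
    next
      case False
      define m where "m = j div 2"
      have j: "2 * s + 2 \<le> real j"
        using False N by linarith
      have "2 * m \<le> j" "j \<le> 2 * m + 1" "m < j"
        using False by (auto simp: m_def N_def)
      then have m: "real m \<le> real j / 2" "real j \<le> 2 * real m + 1"
        by linarith+
      have "s \<le> real m"
        using j m by linarith
      have "F j \<le> (real j + 1) * \<bar>a j\<bar> + (real j + 1) / 2 * \<bar>tree_sum a m\<bar>"
      proof -
        have "\<bar>tree_sum a j\<bar> \<le> \<bar>a j\<bar> + \<bar>tree_sum a m\<bar> / 2"
          unfolding tree_sum_eq[of a j] m_def by linarith
        then have "(real j + 1) * \<bar>tree_sum a j\<bar> \<le> (real j + 1) * (\<bar>a j\<bar> + \<bar>tree_sum a m\<bar> / 2)"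
          by (intro mult_left_mono) auto
        then show ?thesis
          by (simp add: F_def algebra_simps add_divide_distrib)
      qed
      also have "(real j + 1) / 2 * \<bar>tree_sum a m\<bar> \<le> F m"
        unfolding F_def using m by (intro mult_right_mono) auto
      also have "F m \<le> K + 4 * integral {s..real m} b"
        by (rule less.IH[OF \<open>m < j\<close>])
      also have "(real j + 1) * \<bar>a j\<bar> \<le> 4 * integral {real m..real j} b"
      proof -
        have "(real j + 1) * \<bar>a j\<bar> \<le> (2 * real j) * b (real j)"
          using a[of j] j s by (intro mult_mono) auto
        also have "\<dots> = 4 * integral {real j / 2..real j} (\<lambda>_. b (real j))"
          by simp
        also have "integral {real j / 2..real j} (\<lambda>_. b (real j)) \<le> integral {real j / 2..real j} b"
        proof (intro integral_le int)
          show "b (real j) \<le> b t" if "t \<in> {real j / 2..real j}" for t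
            using that j by (intro monotone_onD[OF b(1)]) auto
        qed (use j in auto)
        also have "integral {real j / 2..real j} b \<le> integral {real m..real j} b"
          using m \<open>s \<le> real m\<close> by (intro integral_subset_le int) (use j in \<open>auto simp: b\<close>)
        finally show ?thesis
          by simp
      qed
      finally have "F j \<le> 4 * integral {real m..real j} b + (K + 4 * integral {s..real m} b)"
        by simp
      also have "\<dots> = K + 4 * integral {s..real j} b"
        using Henstock_Kurzweil_Integration.integral_combine[OF \<open>s \<le> real m\<close> _ int[OF order_refl], of "real j"] \<open>m < j\<close> by simp
      finally show ?thesis .
    qed
  qed
  then show thesis
    using that unfolding F_def by blast
qed

text \<open>Apply \<open>tree_sum_bound\<close> with a multiple of \<open>\<epsilon> g\<close>, which eventually decreases, and divide by \<open>j\<close>. The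
  integral becomes \<open>O(g(j))\<close> by the hypothesis on \<open>\<integral> \<epsilon> g\<close>, and the constant becomes \<open>O(1/j)\<close>, which is
  \<open>O(g(j))\<close> because \<open>1/t = O(g(t))\<close>.\<close>

lemma tree_sum_bigo:
  fixes a :: "nat \<Rightarrow> real" and \<epsilon> g :: "real \<Rightarrow> real"
  assumes g: "continuous_on {0..} g" "\<And>t. 0 \<le> t \<Longrightarrow> 0 < g t" "antimono_on {s..} g"
    and lower: "(\<lambda>t. inverse t) \<in> O[at_top](g)"
    and t0: "0 \<le> t0" and eps: "\<And>t. t0 \<le> t \<Longrightarrow> 0 < \<epsilon> t" "antimono_on {t0..} \<epsilon>"
    and int: "(\<lambda>t. integral {t0..t} (\<lambda>x. \<epsilon> x * g x)) \<in> O[at_top](\<lambda>t. t * g t)"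
    and a: "a \<in> O(\<lambda>j. \<epsilon> (real j) * g (real j))"
  shows "tree_sum a \<in> O(\<lambda>j. g (real j))"
proof -
  let ?f = "\<lambda>x. \<epsilon> x * g x"
  have f0: "0 \<le> ?f t" if "t0 \<le> t" for t
    using that t0 eps(1)[of t] g(2)[of t] by simp
  \<comment> \<open>An integral of a non-integrable function would be zero by convention and the hypothesis on it void,
    so integrability down to \<open>t0\<close> matters. The second mean value theorem provides it for a product of
    a monotone and a continuous function.\<close>
  have fint: "?f integrable_on {x..y}" if "t0 \<le> x" for x y
  proof (cases "x \<le> y")
    case True
    have "g integrable_on {x..y}"
      using that t0 by (intro integrable_continuous_real continuous_on_subset[OF g(1)]) auto
    moreover have "- \<epsilon> u \<le> - \<epsilon> v" if "x \<le> u" "u \<le> v" "v \<le> y" for u v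
      using that \<open>t0 \<le> x\<close> by (auto intro!: monotone_onD[OF eps(2)])
    ultimately have "(\<lambda>x. - \<epsilon> x * g x) integrable_on {x..y}"
      using second_mean_value_theorem_full[OF _ True, of g "\<lambda>x. - \<epsilon> x"] by (metis real_scaleR_def has_integral_integrable)
    then show ?thesis
      using integrable_neg by fastforce
  qed auto
  obtain C where C: "0 < C" "\<forall>\<^sub>F j in sequentially. norm (a j) \<le> C * norm (?f (real j))"
    using a by (auto elim: landau_o.bigE)
  then obtain N where N: "\<And>j. j \<ge> N \<Longrightarrow> norm (a j) \<le> C * norm (?f (real j))"
    by (auto simp: eventually_sequentially)
  define r where "r = max (real N) (max s t0)"
  have r: "real N \<le> r" "s \<le> r" "t0 \<le> r" "0 \<le> r"
    using t0 by (auto simp: r_def)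
  define b where "b t = C * ?f t" for t
  have "antimono_on {r..} b"
  proof (rule monotone_onI)
    fix x y assume xy: "x \<in> {r..}" "y \<in> {r..}" "x \<le> y"
    have "?f y \<le> ?f x"
    proof (rule mult_mono)
      show "\<epsilon> y \<le> \<epsilon> x" "g y \<le> g x"
        using xy r by (auto intro: monotone_onD[OF eps(2)] monotone_onD[OF g(3)])
      show "0 \<le> \<epsilon> x" "0 \<le> g y"
        using xy r t0 eps(1)[of x] g(2)[of y] by auto
    qed
    then show "b x \<ge> b y"
      using C(1) by (simp add: b_def)
  qed
  moreover have "0 \<le> b t" if "r \<le> t" for t
    using that f0[of t] r C(1) by (simp add: b_def)
  moreover have "\<bar>a j\<bar> \<le> b (real j)" if "r \<le> real j" for j
    using N[of j] that r f0[of "real j"] by (simp add: b_def)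
  ultimately obtain K where K: "\<And>j. (real j + 1) * \<bar>tree_sum a j\<bar> \<le> K + 4 * integral {r..real j} b"
    using tree_sum_bound[of r b a] r by metis
  obtain D where D: "0 < D" "\<forall>\<^sub>F t in at_top. norm (integral {t0..t} ?f) \<le> D * norm (t * g t)"
    using int by (auto elim: landau_o.bigE)
  obtain E where E: "0 < E" "\<forall>\<^sub>F t in at_top. norm (inverse t) \<le> E * norm (g t)"
    using lower by (auto elim: landau_o.bigE)
  have "\<forall>\<^sub>F t in at_top. t > r \<and> t > 0 \<and> integral {t0..t} ?f \<le> D * (t * g t) \<and> 1 \<le> E * (t * g t)"
    using D(2) E(2) eventually_gt_at_top[of r] eventually_gt_at_top[of 0]
  proof eventually_elim
    case (elim t)
    then show ?case
      using g(2)[of t] by (auto simp: field_simps)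
  qed
  then have ev: "\<forall>\<^sub>F j in sequentially. real j > r \<and> real j > 0 \<and>
      integral {t0..real j} ?f \<le> D * (real j * g (real j)) \<and> 1 \<le> E * (real j * g (real j))"
    by (rule eventually_compose_filterlim[OF _ filterlim_real_sequentially])
  show ?thesis
  proof (rule bigoI)
    show "\<forall>\<^sub>F j in sequentially. norm (tree_sum a j) \<le> (\<bar>K\<bar> * E + 4 * C * D) * norm (g (real j))"
      using ev
    proof eventually_elim
      case (elim j)
      have gj: "0 < g (real j)"
        using g(2) by simp
      have "integral {r..real j} b = C * integral {r..real j} ?f"
        unfolding b_def by simp
      also have "\<dots> \<le> C * integral {t0..real j} ?f"
        using C(1) r by (intro mult_left_mono integral_subset_le fint) (auto intro: f0)
      also have "\<dots> \<le> C * (D * (real j * g (real j)))"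
        using C(1) elim by (intro mult_left_mono) auto
      finally have 1: "integral {r..real j} b \<le> C * (D * (real j * g (real j)))" .
      have 2: "K \<le> \<bar>K\<bar> * (E * (real j * g (real j)))"
        using elim mult_left_mono[of 1 "E * (real j * g (real j))" "\<bar>K\<bar>"] by simp
      have "real j * \<bar>tree_sum a j\<bar> \<le> (real j + 1) * \<bar>tree_sum a j\<bar>"
        by (intro mult_right_mono) auto
      also have "\<dots> \<le> K + 4 * integral {r..real j} b"
        by (rule K)
      also have "\<dots> \<le> real j * ((\<bar>K\<bar> * E + 4 * C * D) * g (real j))"
        using 1 2 by (simp add: algebra_simps)
      finally show ?case
        using elim gj by simp
    qed
  qed
qed

section \<open>Traces on the ideal\<close>

locale ideal_trace =
  fixes g :: "real \<Rightarrow> real" and s :: real and \<phi> :: "('a::complex_hilbert \<Rightarrow> 'a) \<Rightarrow> complex"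
  assumes inf: "\<nexists>B :: 'a set. finite B \<and> cspan B = UNIV"
    and g_pos: "\<And>t. 0 \<le> t \<Longrightarrow> 0 < g t" and g_anti: "antimono_on {s..} g" and g_0: "(g \<longlongrightarrow> 0) at_top"
    and trace: "is_trace g \<phi>"
begin

lemma in_ideal:
  fixes u v :: "nat \<Rightarrow> 'a"
  shows "orthonormal u \<Longrightarrow> orthonormal v \<Longrightarrow> c \<in> O(\<lambda>j. g (real j)) \<Longrightarrow> schmidt c u v \<in> weak_lorentz g"
  by (rule schmidt_in_weak_lorentz[OF inf _ _ g_pos g_anti g_0])

lemma bigo_Bseq:
  assumes "c \<in> O(\<lambda>j. g (real j))"
  shows "Bseq c"
proof -
  have "c \<longlonglongrightarrow> 0"
    by (rule bigo_tendsto_0[OF assms filterlim_compose[OF g_0 filterlim_real_sequentially]])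
  then show ?thesis
    by (rule convergent_imp_Bseq[OF convergentI])
qed

lemma trace_add:
  "S \<in> weak_lorentz g \<Longrightarrow> T \<in> weak_lorentz g \<Longrightarrow> \<phi> (\<lambda>x. S x + T x) = \<phi> S + \<phi> T"
  using trace by (simp add: is_trace_def)

lemma trace_scale: "T \<in> weak_lorentz g \<Longrightarrow> \<phi> (\<lambda>x. c *\<^sub>C T x) = c * \<phi> T"
  using trace by (simp add: is_trace_def)

lemma trace_commutator:
  "T \<in> weak_lorentz g \<Longrightarrow> bounded_clinear A \<Longrightarrow> \<phi> (\<lambda>x. A (T x) - T (A x)) = 0"
  using trace by (simp add: is_trace_def)

lemma trace_schmidt_add:
  assumes "orthonormal u" "c \<in> O(\<lambda>j. g (real j))" "d \<in> O(\<lambda>j. g (real j))"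
  shows "\<phi> (schmidt (\<lambda>n. c n + d n) u u) = \<phi> (schmidt c u u) + \<phi> (schmidt d u u)"
  using assms by (simp add: schmidt_add bigo_Bseq trace_add in_ideal)

lemma trace_schmidt_scale:
  assumes "orthonormal u" "c \<in> O(\<lambda>j. g (real j))"
  shows "\<phi> (schmidt (\<lambda>n. k * c n) u u) = of_real k * \<phi> (schmidt c u u)"
  using assms by (simp only: schmidt_scale bigo_Bseq trace_scale in_ideal)

lemma trace_schmidt_diff:
  assumes u: "orthonormal u" "orthonormal v" and c: "c \<in> O(\<lambda>j. g (real j))" "d \<in> O(\<lambda>j. g (real j))"
  shows "\<phi> (\<lambda>x. schmidt c u u x - schmidt d v v x) = \<phi> (schmidt c u u) - \<phi> (schmidt d v v)"
proof -
  have "schmidt (\<lambda>n. (-1) * d n) v v \<in> weak_lorentz g"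
    using c(2) by (intro in_ideal u) simp
  then have "(\<lambda>x. (-1) *\<^sub>C schmidt d v v x) \<in> weak_lorentz g"
    by (simp only: schmidt_scale[OF u(2,2) bigo_Bseq[OF c(2)]] of_real_minus of_real_1)
  then have "\<phi> (\<lambda>x. schmidt c u u x + (-1) *\<^sub>C schmidt d v v x)
      = \<phi> (schmidt c u u) + (-1) * \<phi> (schmidt d v v)"
    using trace_add[of "schmidt c u u"] trace_scale[of "schmidt d v v" "-1"] in_ideal u c by metis
  then show ?thesis
    by (simp add: complex_vector.scale_minus_left scaleC_one)
qed

text \<open>The two diagonal operators are the products \<open>A X\<close> and \<open>X A\<close> for the partial isometry \<open>A\<close> that maps \<open>v n\<close> to
  \<open>u n\<close> and \<open>X = schmidt c u v\<close>.\<close>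

lemma trace_schmidt_unitarily_invariant:
  assumes u: "orthonormal u" "orthonormal v" and c: "c \<in> O(\<lambda>j. g (real j))"
  shows "\<phi> (schmidt c u u) = \<phi> (schmidt c v v)"
proof -
  let ?A = "schmidt (\<lambda>_. 1) v u"
  have "bounded_clinear ?A"
    by (intro bounded_clinear_schmidt u) auto
  then have "\<phi> (\<lambda>x. ?A (schmidt c u v x) - schmidt c u v (?A x)) = 0"
    by (intro trace_commutator in_ideal u c)
  then have "\<phi> (\<lambda>x. schmidt c u u x - schmidt c v v x) = 0"
    using bigo_Bseq[OF c] u by (simp add: schmidt_compose)
  then show ?thesis
    using trace_schmidt_diff[OF u c c] by simp
qed

text \<open>Writing every entry of the sequence twice turns a diagonal operator into the sum of two copies of
  it, one along the even and one along the odd basis vectors.\<close>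

lemma trace_schmidt_doubling:
  assumes e: "orthonormal_basis (e :: nat \<Rightarrow> 'a)" and y: "y \<in> O(\<lambda>j. g (real j))"
  shows "\<phi> (schmidt (\<lambda>j. y (j div 2)) e e) = 2 * \<phi> (schmidt y e e)"
proof -
  have oe: "orthonormal e"
    using e by (rule orthonormal_basis_orthonormal)
  define ev where "ev = (\<lambda>j. e (2 * j))"
  define od where "od = (\<lambda>j. e (2 * j + 1))"
  have u: "orthonormal ev" "orthonormal od"
    unfolding ev_def od_def by (auto intro!: orthonormal_compose[OF oe] injI)
  have By: "Bseq y" and By2: "Bseq (\<lambda>j. y (j div 2))"
    using bigo_Bseq[OF y] by (auto simp: Bseq_def)
  have Bev: "bounded_clinear (schmidt y ev ev)" and Bod: "bounded_clinear (schmidt y od od)"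
    using u By by (auto intro: bounded_clinear_schmidt)
  have "(\<lambda>x. schmidt y ev ev x + schmidt y od od x) = schmidt (\<lambda>j. y (j div 2)) e e"
  proof (rule schmidt_eqI[OF oe oe By2])
    show "bounded_clinear (\<lambda>x. schmidt y ev ev x + schmidt y od od x)"
      using Bev Bod by (auto simp: bounded_clinear_def scaleC_add_right intro: bounded_linear_add)
    show "schmidt y ev ev (e n) + schmidt y od od (e n) = complex_of_real (y (n div 2)) *\<^sub>C e n" for n
    proof (cases "even n")
      case True
      then obtain m where n: "n = 2 * m"
        by blast
      have "schmidt y od od (e n) = 0"
        by (rule schmidt_orthogonal) (auto simp: od_def n orthonormal_cinner[OF oe], presburger)
      moreover have "schmidt y ev ev (e n) = complex_of_real (y m) *\<^sub>C e n"
        using schmidt_basis[OF u(1), of y ev m] by (simp add: ev_def n)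
      ultimately show ?thesis
        by (simp add: n)
    next
      case False
      then obtain m where n: "n = 2 * m + 1"
        by (elim oddE)
      have "schmidt y ev ev (e n) = 0"
        by (rule schmidt_orthogonal) (auto simp: ev_def n orthonormal_cinner[OF oe], presburger)
      moreover have "schmidt y od od (e n) = complex_of_real (y m) *\<^sub>C e n"
        using schmidt_basis[OF u(2), of y od m] by (simp add: od_def n)
      ultimately show ?thesis
        by (simp add: n)
    qed
  next
    fix x assume "\<And>n. cinner (e n) x = 0"
    then show "schmidt y ev ev x + schmidt y od od x = 0"
      by (simp add: schmidt_orthogonal ev_def od_def)
  qed
  then have "\<phi> (schmidt (\<lambda>j. y (j div 2)) e e) = \<phi> (schmidt y ev ev) + \<phi> (schmidt y od od)"
    using trace_add in_ideal u y by metis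
  then show ?thesis
    using trace_schmidt_unitarily_invariant[OF oe u(1) y] trace_schmidt_unitarily_invariant[OF oe u(2) y] by simp
qed

text \<open>Let \<open>y = tree_sum a\<close>. The equation \<open>y j = a j + y (j div 2) / 2\<close> and the doubling rule give
  \<open>\<phi>(y) = \<phi>(a) + (1/2) \<cdot> 2 \<phi>(y)\<close> for the values of the trace on the diagonal operators.\<close>

lemma trace_schmidt_tree_sum:
  assumes e: "orthonormal_basis (e :: nat \<Rightarrow> 'a)"
    and a: "a \<in> O(\<lambda>j. g (real j))" and y: "tree_sum a \<in> O(\<lambda>j. g (real j))"
  shows "\<phi> (schmidt a e e) = 0"
proof -
  have oe: "orthonormal e"
    using e by (rule orthonormal_basis_orthonormal)
  have half: "(\<lambda>j. (1/2) * tree_sum a (j div 2)) = (\<lambda>j. tree_sum a j - a j)"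
    by (rule ext, subst tree_sum_eq) simp
  have parent: "(\<lambda>j. tree_sum a (j div 2)) \<in> O(\<lambda>j. g (real j))"
  proof -
    have "(\<lambda>j. (1/2) * tree_sum a (j div 2)) \<in> O(\<lambda>j. g (real j))"
      unfolding half by (rule sum_in_bigo(2)[OF y a])
    then show ?thesis
      by simp
  qed
  have "tree_sum a = (\<lambda>j. a j + (1/2) * tree_sum a (j div 2))"
    by (rule ext, subst tree_sum_eq) simp
  then have "\<phi> (schmidt (tree_sum a) e e) = \<phi> (schmidt (\<lambda>j. a j + (1/2) * tree_sum a (j div 2)) e e)"
    by simp
  also have "\<dots> = \<phi> (schmidt a e e) + \<phi> (schmidt (\<lambda>j. (1/2) * tree_sum a (j div 2)) e e)"
    using parent by (intro trace_schmidt_add oe a) simp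
  also have "\<phi> (schmidt (\<lambda>j. (1/2) * tree_sum a (j div 2)) e e) = \<phi> (schmidt (tree_sum a) e e)"
    unfolding trace_schmidt_scale[OF oe parent] trace_schmidt_doubling[OF e y] by simp
  finally show ?thesis
    by simp
qed

end

lemma model_operator_schmidt:
  assumes e: "orthonormal_basis e" and "Bseq (\<lambda>j. g (real j))"
  shows "is_model_operator g (schmidt (\<lambda>j. g (real j)) e e)"
  unfolding is_model_operator_def
  using assms orthonormal_basis_orthonormal[OF e] by (auto intro: bounded_clinear_schmidt schmidt_basis)

text \<open>In a sequence of eigenvectors of \<open>T\<close> with eigenvalues \<open>c n\<close>, the parts of \<open>T\<close> are diagonal with entries
  \<open>(\<bar>c n\<bar> \<plusminus> c n) / 2\<close>.\<close>

lemma self_adjoint_compact_parts: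
  fixes T :: "'a::complex_hilbert \<Rightarrow> 'a"
  assumes inf: "\<nexists>B :: 'a set. finite B \<and> cspan B = UNIV"
    and T: "compact_op T" "\<And>x y. cinner (T x) y = cinner x (T y)"
  shows "positive_op (pos_part T)" "compact_op (pos_part T)"
    and "positive_op (neg_part T)" "compact_op (neg_part T)"
    and "T = (\<lambda>x. pos_part T x - neg_part T x)"
proof -
  obtain u c where u: "orthonormal u" and Tc: "T = schmidt c u u" and c: "c \<longlonglongrightarrow> 0"
    using compact_symmetric_spectral_theorem[OF inf T] by blast
  have Bc: "Bseq c"
    by (rule convergent_imp_Bseq[OF convergentI[OF c]])
  have "(\<lambda>n. (1/2) * (\<bar>c n\<bar> + c n)) \<longlonglongrightarrow> (1/2) * (\<bar>0\<bar> + 0)"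
    "(\<lambda>n. (1/2) * (\<bar>c n\<bar> + (-1) * c n)) \<longlonglongrightarrow> (1/2) * (\<bar>0\<bar> + (-1) * 0)"
    by (intro tendsto_intros c)+
  then have lim: "(\<lambda>n. (1/2) * (\<bar>c n\<bar> + c n)) \<longlonglongrightarrow> 0" "(\<lambda>n. (1/2) * (\<bar>c n\<bar> + (-1) * c n)) \<longlonglongrightarrow> 0"
    by simp_all
  then have "Bseq (\<lambda>n. (1/2) * (\<bar>c n\<bar> + c n))" "Bseq (\<lambda>n. (1/2) * (\<bar>c n\<bar> + (-1) * c n))"
    by (auto simp only: convergent_def intro!: convergent_imp_Bseq)
  then show "positive_op (pos_part T)" "positive_op (neg_part T)"
    unfolding Tc pos_part_schmidt[OF u Bc] neg_part_schmidt[OF u Bc]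
    by (auto intro!: positive_op_schmidt u)
  show "compact_op (pos_part T)" "compact_op (neg_part T)"
    unfolding Tc pos_part_schmidt[OF u Bc] neg_part_schmidt[OF u Bc]
    by (intro compact_op_schmidt u lim)+
  show "T = (\<lambda>x. pos_part T x - neg_part T x)"
    unfolding pos_part_def neg_part_def
    by (rule ext) (simp add: algebra_simps flip: scaleR_add_left)
qed

context ideal_trace
begin

text \<open>The error terms \<open>g(j) r j\<close> contribute nothing by \<open>trace_schmidt_tree_sum\<close>, so only the multiple of the
  model operator is left.\<close>

lemma trace_asymptotic_model:
  assumes e: "orthonormal_basis (e :: nat \<Rightarrow> 'a)" and u: "orthonormal u"
    and l: "\<And>j. l j = g (real j) * (c + r j)"
    and err: "(\<lambda>j. g (real j) * r j) \<in> O(\<lambda>j. g (real j))"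
      "tree_sum (\<lambda>j. g (real j) * r j) \<in> O(\<lambda>j. g (real j))"
  shows "l \<in> O(\<lambda>j. g (real j))"
    and "\<phi> (schmidt l u u) = of_real c * \<phi> (schmidt (\<lambda>j. g (real j)) e e)"
proof -
  have oe: "orthonormal e"
    using e by (rule orthonormal_basis_orthonormal)
  have l_eq: "l = (\<lambda>j. c * g (real j) + g (real j) * r j)"
    by (rule ext) (simp add: l algebra_simps)
  have model: "(\<lambda>j. c * g (real j)) \<in> O(\<lambda>j. g (real j))" "(\<lambda>j. g (real j)) \<in> O(\<lambda>j. g (real j))"
    by simp_all
  show bigo: "l \<in> O(\<lambda>j. g (real j))"
    unfolding l_eq by (rule sum_in_bigo(1)[OF model(1) err(1)])
  have "\<phi> (schmidt l u u) = \<phi> (schmidt l e e)"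
    by (rule trace_schmidt_unitarily_invariant[OF u oe bigo])
  also have "\<dots> = \<phi> (schmidt (\<lambda>j. c * g (real j)) e e) + \<phi> (schmidt (\<lambda>j. g (real j) * r j) e e)"
    unfolding l_eq by (rule trace_schmidt_add[OF oe model(1) err(1)])
  also have "\<dots> = of_real c * \<phi> (schmidt (\<lambda>j. g (real j)) e e)"
    by (simp add: trace_schmidt_tree_sum[OF e err] trace_schmidt_scale[OF oe model(2)])
  finally show "\<phi> (schmidt l u u) = of_real c * \<phi> (schmidt (\<lambda>j. g (real j)) e e)" .
qed

end

section \<open>Hypermeasurable operators\<close>

theorem proposition2:
  fixes g \<epsilon> :: "real \<Rightarrow> real"
    and T :: "'a::complex_hilbert \<Rightarrow> 'a"
    and cp cm t0 :: real
  assumes separable: "separable_space (euclidean :: 'a topology)"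
    and infinite_dim: "\<nexists>B :: 'a set. finite B \<and> cspan B = UNIV"
    and g_RV: "RV_minus_one g"
    and g_int: "filterlim (\<lambda>t. integral {0..t} g) at_top at_top"
    and g_lower: "(\<lambda>t. inverse t) \<in> O[at_top](g)"
    and T_in: "T \<in> weak_lorentz g"
    and T_sa: "cadjoint T = T"
    and t0_nonneg: "0 \<le> t0"
    and eps_pos: "\<forall>t\<ge>t0. 0 < \<epsilon> t"
    and eps_decr: "antimono_on {t0..} \<epsilon>"
    and eps_lim: "(\<epsilon> \<longlongrightarrow> 0) at_top"
    and eig_pos: "\<exists>r. r \<in> O(\<lambda>j. \<epsilon> (real j)) \<and>
                    (\<forall>j. eigenvalues (pos_part T) j = g (real j) * (cp + r j))"
    and eig_neg: "\<exists>r. r \<in> O(\<lambda>j. \<epsilon> (real j)) \<and>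
                    (\<forall>j. eigenvalues (neg_part T) j = g (real j) * (cm + r j))"
    and eps_int: "(\<lambda>t. integral {t0..t} (\<lambda>s. \<epsilon> s * g s)) \<in> O[at_top](\<lambda>t. t * g t)"
  shows "hypermeasurable g T"
proof -
  obtain e :: "nat \<Rightarrow> 'a" where e: "orthonormal_basis e"
    using orthonormal_basis_exists[OF infinite_dim separable] by blast
  then have oe: "orthonormal e"
    by (rule orthonormal_basis_orthonormal)
  obtain a where a: "antimono_on {a..} g"
    using RV_minus_one_antimono[OF g_RV] by blast
  have g: "continuous_on {0..} g" "\<And>t. 0 \<le> t \<Longrightarrow> 0 < g t" "(g \<longlongrightarrow> 0) at_top"
    using g_RV RV_minus_one_tendsto_0 by (auto simp: RV_minus_one_def)
  have eps_bounded: "(\<lambda>j. \<epsilon> (real j)) \<in> O(\<lambda>_. 1)"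
    by (intro bigoI_tendsto[where c = 0])
      (use filterlim_compose[OF eps_lim filterlim_real_sequentially] in auto)

  have T: "compact_op T"
    using T_in by (simp add: weak_lorentz_def)
  then have "bounded_clinear T"
    by (simp add: compact_op_def)
  note parts = self_adjoint_compact_parts[OF infinite_dim T cadjoint_symmetric[OF e this T_sa]]
  obtain u where u: "orthonormal u" "pos_part T = schmidt (eigenvalues (pos_part T)) u u"
    using positive_compact_spectral_theorem[OF infinite_dim parts(1,2)] by blast
  obtain v where v: "orthonormal v" "neg_part T = schmidt (eigenvalues (neg_part T)) v v"
    using positive_compact_spectral_theorem[OF infinite_dim parts(3,4)] by blast
  obtain rp where rp: "rp \<in> O(\<lambda>j. \<epsilon> (real j))" "\<And>j. eigenvalues (pos_part T) j = g (real j) * (cp + rp j)"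
    using eig_pos by blast
  obtain rm where rm: "rm \<in> O(\<lambda>j. \<epsilon> (real j))" "\<And>j. eigenvalues (neg_part T) j = g (real j) * (cm + rm j)"
    using eig_neg by blast

  have err: "(\<lambda>j. g (real j) * r j) \<in> O(\<lambda>j. g (real j))"
    "tree_sum (\<lambda>j. g (real j) * r j) \<in> O(\<lambda>j. g (real j))"
    if r: "r \<in> O(\<lambda>j. \<epsilon> (real j))" for r
  proof -
    show "(\<lambda>j. g (real j) * r j) \<in> O(\<lambda>j. g (real j))"
      using landau_o.big.mult[OF landau_o.big_refl landau_o.big_trans[OF r eps_bounded], of "\<lambda>j. g (real j)"]
      by simp
    have "(\<lambda>j. g (real j) * r j) \<in> O(\<lambda>j. \<epsilon> (real j) * g (real j))"
      using landau_o.big.mult[OF r landau_o.big_refl, of "\<lambda>j. g (real j)"] by (simp add: mult.commute)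
    then show "tree_sum (\<lambda>j. g (real j) * r j) \<in> O(\<lambda>j. g (real j))"
      using eps_pos by (intro tree_sum_bigo[OF g(1,2) a g_lower t0_nonneg _ eps_decr eps_int]) auto
  qed

  have trace_value: "\<phi> T = of_real cp - of_real cm" if "is_normalized_trace g \<phi>" for \<phi> :: "('a \<Rightarrow> 'a) \<Rightarrow> complex"
  proof -
    interpret ideal_trace g a \<phi>
      using that infinite_dim g a by unfold_locales (auto simp: is_normalized_trace_def)
    have "\<phi> (schmidt (\<lambda>j. g (real j)) e e) = 1"
      using that model_operator_schmidt[OF e bigo_Bseq[OF landau_o.big_refl]]
      by (simp add: is_normalized_trace_def)
    moreover note pos = trace_asymptotic_model[OF e u(1) rp(2) err[OF rp(1)]]
    moreover note neg = trace_asymptotic_model[OF e v(1) rm(2) err[OF rm(1)]]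
    moreover have "\<phi> T = \<phi> (\<lambda>x. schmidt (eigenvalues (pos_part T)) u u x - schmidt (eigenvalues (neg_part T)) v v x)"
      using parts(5) u(2) v(2) by metis
    ultimately show ?thesis
      by (simp add: trace_schmidt_diff[OF u(1) v(1) pos(1) neg(1)])
  qed
  show ?thesis
    unfolding hypermeasurable_def
  proof (intro conjI allI impI T_in)
    fix \<phi> \<psi> :: "('a \<Rightarrow> 'a) \<Rightarrow> complex"
    assume "is_normalized_trace g \<phi> \<and> is_normalized_trace g \<psi>"
    then show "\<phi> T = \<psi> T"
      using trace_value[of \<phi>] trace_value[of \<psi>] by simp
  qed
qed

end
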